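(* There exist two isometric analytic tori in $\mathbb{R}^3$ not related by an ambient isometry. That is, there exist a real analytic torus $T$ (a compact real analytic orientable surface of genus one) and two real analytic immersions $f^+,f^-:T\to\mathbb{R}^3$ inducing the same Riemannian metric on $T$, such that the immersed surfaces $f^+$ and $f^-$ are not related by any isometry of $\mathbb{R}^3$.
   Context: Isometries of $\mathbb{R}^3$ include both rigid motions and reflections. The immersed surfaces $f^+$ and $f^-$ are related by an ambient isometry if there are an isometry $F$ of $\mathbb{R}^3$ and a diffeomorphism $\varphi:T\to T$ with $f^-=F\circ f^+\circ\varphi$. *)

theory Defs
  imports "HOL-Analysis.Analysis"
begin

section \<open>Real analytic and smooth maps between Euclidean spaces\<close>

text \<open>
  A function is real analytic at \<open>x\<close> if near \<open>x\<close> it is the sum of a power series in the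
  coordinates. The index \<open>\<alpha>\<close> ranges over all multi-indices in \<open>'n \<Rightarrow> nat\<close>.
\<close>

definition real_analytic_at :: "(real ^ 'n \<Rightarrow> 'b::real_normed_vector) \<Rightarrow> real ^ 'n \<Rightarrow> bool" where
  "real_analytic_at f x \<longleftrightarrow>
     (\<exists>(a :: ('n \<Rightarrow> nat) \<Rightarrow> 'b) r. r > 0 \<and>
        (\<forall>h. norm h < r \<longrightarrow>
           ((\<lambda>\<alpha>. (\<Prod>i\<in>UNIV. (h $ i) ^ \<alpha> i) *\<^sub>R a \<alpha>) has_sum f (x + h)) UNIV))"

text \<open>
  The next three notions are meant for open \<open>S\<close>; on such sets \<open>f\<close> may be junk outside \<open>S\<close>.
\<close>

definition real_analytic_on_open ::
    "(real ^ 'n \<Rightarrow> 'b::real_normed_vector) \<Rightarrow> (real ^ 'n) set \<Rightarrow> bool" where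
  "real_analytic_on_open f S \<longleftrightarrow> (\<forall>x\<in>S. real_analytic_at f x)"

primrec C_k_on ::
    "nat \<Rightarrow> ('a::real_normed_vector \<Rightarrow> 'b::real_normed_vector) \<Rightarrow> 'a set \<Rightarrow> bool" where
  "C_k_on 0 f S \<longleftrightarrow> continuous_on S f"
| "C_k_on (Suc k) f S \<longleftrightarrow>
     (\<forall>x\<in>S. f differentiable (at x)) \<and>
     (\<forall>v. C_k_on k (\<lambda>x. frechet_derivative f (at x) v) S)"

definition smooth_on_open ::
    "('a::real_normed_vector \<Rightarrow> 'b::real_normed_vector) \<Rightarrow> 'a set \<Rightarrow> bool" where
  "smooth_on_open f S \<longleftrightarrow> (\<forall>k. C_k_on k f S)"

section \<open>Real analytic surfaces\<close>

text \<open>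
  A chart is a pair of its domain and its coordinate map, whose values outside the domain are
  irrelevant.
\<close>

type_synonym 'a chart = "'a set \<times> ('a \<Rightarrow> real ^ 2)"

abbreviation chart_dom :: "'a chart \<Rightarrow> 'a set" where
  "chart_dom c \<equiv> fst c"

abbreviation chart_map :: "'a chart \<Rightarrow> 'a \<Rightarrow> real ^ 2" where
  "chart_map c \<equiv> snd c"

definition chart_inv :: "'a chart \<Rightarrow> real ^ 2 \<Rightarrow> 'a" where
  "chart_inv c = inv_into (chart_dom c) (chart_map c)"

definition is_chart :: "'a topology \<Rightarrow> 'a chart \<Rightarrow> bool" where
  "is_chart X c \<longleftrightarrow>
     openin X (chart_dom c) \<and>
     open (chart_map c ` chart_dom c) \<and>
     homeomorphic_map (subtopology X (chart_dom c))
       (top_of_set (chart_map c ` chart_dom c)) (chart_map c)"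

definition transition :: "'a chart \<Rightarrow> 'a chart \<Rightarrow> real ^ 2 \<Rightarrow> real ^ 2" where
  "transition c d = chart_map d \<circ> chart_inv c"

definition overlap :: "'a chart \<Rightarrow> 'a chart \<Rightarrow> (real ^ 2) set" where
  "overlap c d = chart_map c ` (chart_dom c \<inter> chart_dom d)"

definition real_analytic_atlas :: "'a topology \<Rightarrow> 'a chart set \<Rightarrow> bool" where
  "real_analytic_atlas X A \<longleftrightarrow>
     (\<forall>c\<in>A. is_chart X c) \<and>
     (\<Union>c\<in>A. chart_dom c) = topspace X \<and>
     (\<forall>c\<in>A. \<forall>d\<in>A. real_analytic_on_open (transition c d) (overlap c d))"

definition real_analytic_surface :: "'a topology \<Rightarrow> 'a chart set \<Rightarrow> bool" where
  "real_analytic_surface X A \<longleftrightarrow>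
     Hausdorff_space X \<and> second_countable X \<and> real_analytic_atlas X A"

text \<open>
  The structure given by \<open>A\<close> is orientable if its maximal atlas contains an oriented atlas \<open>B\<close>;
  \<open>A\<close> itself need not be oriented.
\<close>

definition oriented_atlas :: "'a chart set \<Rightarrow> bool" where
  "oriented_atlas B \<longleftrightarrow>
     (\<forall>c\<in>B. \<forall>d\<in>B. \<forall>x\<in>overlap c d. det (jacobian (transition c d) (at x)) > 0)"

definition orientable_surface :: "'a topology \<Rightarrow> 'a chart set \<Rightarrow> bool" where
  "orientable_surface X A \<longleftrightarrow>
     (\<exists>B. real_analytic_atlas X B \<and> real_analytic_atlas X (A \<union> B) \<and> oriented_atlas B)"

text \<open>
  The closed orientable surface of genus \<open>g\<close> is the sphere with \<open>g\<close> handles (the connected sum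
  of \<open>g\<close> tori), so genus one means homeomorphic to the product of two circles.
\<close>

definition genus_one :: "'a topology \<Rightarrow> bool" where
  "genus_one X \<longleftrightarrow>
     X homeomorphic_space
       prod_topology (top_of_set (sphere (0::complex) 1)) (top_of_set (sphere (0::complex) 1))"

definition real_analytic_torus :: "'a topology \<Rightarrow> 'a chart set \<Rightarrow> bool" where
  "real_analytic_torus X A \<longleftrightarrow>
     real_analytic_surface X A \<and> compact_space X \<and> connected_space X \<and>
     orientable_surface X A \<and> genus_one X"

section \<open>Immersions and their induced metrics\<close>

definition chart_deriv ::
    "('a \<Rightarrow> 'b::real_normed_vector) \<Rightarrow> 'a chart \<Rightarrow> 'a \<Rightarrow> real ^ 2 \<Rightarrow> 'b" where
  "chart_deriv f c p = frechet_derivative (f \<circ> chart_inv c) (at (chart_map c p))"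

definition real_analytic_immersion ::
    "'a chart set \<Rightarrow> ('a \<Rightarrow> 'b::euclidean_space) \<Rightarrow> bool" where
  "real_analytic_immersion A f \<longleftrightarrow>
     (\<forall>c\<in>A. real_analytic_on_open (f \<circ> chart_inv c) (chart_map c ` chart_dom c) \<and>
        (\<forall>p\<in>chart_dom c. inj (chart_deriv f c p)))"

text \<open>
  The pullback of the Euclidean metric, evaluated at \<open>p\<close> on the tangent vectors with components
  \<open>v\<close> and \<open>w\<close> in the chart \<open>c\<close>.
\<close>

definition induced_metric ::
    "('a \<Rightarrow> 'b::euclidean_space) \<Rightarrow> 'a chart \<Rightarrow> 'a \<Rightarrow> real ^ 2 \<Rightarrow> real ^ 2 \<Rightarrow> real" where
  "induced_metric f c p v w = chart_deriv f c p v \<bullet> chart_deriv f c p w"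

definition same_induced_metric ::
    "'a chart set \<Rightarrow> ('a \<Rightarrow> 'b::euclidean_space) \<Rightarrow> ('a \<Rightarrow> 'b) \<Rightarrow> bool" where
  "same_induced_metric A f g \<longleftrightarrow>
     (\<forall>c\<in>A. \<forall>p\<in>chart_dom c. \<forall>v w. induced_metric f c p v w = induced_metric g c p v w)"

section \<open>Surfaces related by an ambient isometry\<close>

definition smooth_in_charts :: "'a chart set \<Rightarrow> ('a \<Rightarrow> 'a) \<Rightarrow> bool" where
  "smooth_in_charts A h \<longleftrightarrow>
     (\<forall>c\<in>A. \<forall>d\<in>A.
        smooth_on_open (chart_map d \<circ> h \<circ> chart_inv c)
          (chart_map c ` {p \<in> chart_dom c. h p \<in> chart_dom d}))"

definition self_diffeomorphism :: "'a topology \<Rightarrow> 'a chart set \<Rightarrow> ('a \<Rightarrow> 'a) \<Rightarrow> bool" where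
  "self_diffeomorphism X A h \<longleftrightarrow>
     (\<exists>h'. homeomorphic_maps X X h h' \<and> smooth_in_charts A h \<and> smooth_in_charts A h')"

text \<open>
  Distance-preserving self-maps of a Euclidean space; these are automatically bijective and
  include the orientation-reversing ones.
\<close>

definition ambient_isometry :: "('b::euclidean_space \<Rightarrow> 'b) \<Rightarrow> bool" where
  "ambient_isometry F \<longleftrightarrow> (\<forall>x y. dist (F x) (F y) = dist x y)"

definition related_by_ambient_isometry ::
    "'a topology \<Rightarrow> 'a chart set \<Rightarrow> ('a \<Rightarrow> 'b::euclidean_space) \<Rightarrow> ('a \<Rightarrow> 'b) \<Rightarrow> bool" where
  "related_by_ambient_isometry X A f g \<longleftrightarrow>
     (\<exists>F h. ambient_isometry F \<and> self_diffeomorphism X A h \<and>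
        (\<forall>p\<in>topspace X. g p = F (f (h p))))"

end

theory Submission
  imports Defs "HOL-Complex_Analysis.Cauchy_Integral_Formula"
begin

text \<open>
  Two maps \<open>A\<close> and \<open>B\<close> from a surface to space with \<open>dA \<cdot> dB = 0\<close> (symmetrised) give isometric
  surfaces \<open>A + B\<close> and \<open>A - B\<close>, because \<open>|dA + dB|\<^sup>2 = |dA|\<^sup>2 + |dB|\<^sup>2 = |dA - dB|\<^sup>2\<close>. So the task is to
  find an analytic torus \<open>A\<close> with an infinitesimal bending \<open>B\<close> for which the two results are not
  congruent.

  The starting point is a surface of revolution \<open>f\<close> with profile curve \<open>(r, z)\<close> which runs three times
  round its axis: the rotation angle is \<open>3 p\<close>, where \<open>p\<close> has period \<open>2 \<pi>\<close>. A bending \<open>h\<close> of frequency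
  \<open>4 / 3\<close> in the rotation angle has, in the rotating orthonormal frame, the components
  \<open>- (4 / 3) \<tau> cos 4p\<close>, \<open>\<tau> sin 4p\<close> and \<open>\<zeta> cos 4p\<close>, and \<open>df \<cdot> dh = 0\<close> comes down to two equations for
  \<open>r\<close>, \<open>z\<close>, \<open>\<tau>\<close>, \<open>\<zeta>\<close> as functions of the profile parameter \<open>t\<close>. With \<open>\<tau> = sin\<^sup>2 t\<close> they are the
  equations \<open>bending\<close> in the locale \<open>flexible_profile\<close>. They have a solution in closed form,
  up to one quadrature for \<open>z\<close>; the profile closes up because \<open>z\<close> changes its sign under
  \<open>t \<mapsto> t + \<pi>\<close> while \<open>r\<close> does not (\<open>profile_bending\<close>, \<open>height_shift\<close>).

  The surfaces \<open>f + h\<close> and \<open>f - h\<close> are congruent, since \<open>p \<mapsto> p + \<pi> / 4\<close> combined with a rotation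
  of space preserves \<open>f\<close> and reverses \<open>h\<close>. Two modifications keep the relation \<open>dA \<cdot> dB = 0\<close> and
  destroy this symmetry. Stretching the axis by \<open>L\<close> replaces \<open>f = (x, y, z)\<close> by \<open>(x, y, L z)\<close> and \<open>h\<close> by
  \<open>k = (h\<^sub>x, h\<^sub>y, h\<^sub>z / L)\<close>; and a multiple of \<open>w \<times> k\<close>, with \<open>w\<close> a fixed vector, may be added to \<open>A\<close>, because
  \<open>(w \<times> dk) \<cdot> dk = 0\<close>. The tori are \<open>A \<plusminus> B\<close> with \<open>A = (x, y, L z) + e L (e\<^sub>1 \<times> k)\<close> and \<open>B = e k\<close>. For
  small \<open>e\<close> they are immersed, uniformly in \<open>L \<ge> 1\<close> (\<open>immersion_for_small_bending\<close>).

  Both tori are symmetric with respect to the origin, by \<open>(t, p) \<mapsto> (t + \<pi>, p + \<pi>)\<close>, so the diameter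
  of each is twice the largest norm of its points, and it suffices to show that these largest norms
  differ. For large \<open>L\<close> the largest norm is decided on the two tip circles \<open>sin t = 0\<close>, where
  \<open>|z|\<close> is maximal and \<open>\<tau>\<close> vanishes; the comparison there is an elementary inequality between
  trigonometric functions of \<open>p\<close> (\<open>tip_inequality\<close>, \<open>bent_tip_far\<close>).
\<close>

section \<open>Real analytic functions of one and two variables\<close>

definition power_series_at :: "(real \<Rightarrow> real) \<Rightarrow> real \<Rightarrow> bool" where
  "power_series_at f x \<longleftrightarrow>
     (\<exists>a e. e > 0 \<and> (\<forall>h. \<bar>h\<bar> < e \<longrightarrow> ((\<lambda>n. a n * h ^ n) has_sum f (x + h)) UNIV))"

text \<open>
  The real parts of the Taylor coefficients of the extension serve as coefficients. Convergence at
  a slightly larger argument makes the series absolutely convergent, which is what an unordered sum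
  asks for.
\<close>

lemma power_series_at_holomorphic_extension:
  fixes f :: "real \<Rightarrow> real" and g :: "complex \<Rightarrow> complex"
  assumes "open U" "of_real x \<in> U" "g holomorphic_on U"
    and ext: "\<And>y. of_real y \<in> U \<Longrightarrow> g (of_real y) = of_real (f y)"
  shows "power_series_at f x"
proof -
  obtain e where e: "e > 0" "ball (of_real x) e \<subseteq> U"
    using assms(1,2) open_contains_ball by blast
  define c where "c n = (deriv ^^ n) g (of_real x) / fact n" for n
  have sums: "(\<lambda>n. Re (c n) * h ^ n) sums f (x + h)" if "\<bar>h\<bar> < e" for h
  proof -
    have w: "of_real (x + h) \<in> ball (of_real x :: complex) e"
      using that by (simp add: dist_norm)
    have "(\<lambda>n. c n * (of_real (x + h) - of_real x) ^ n) sums g (of_real (x + h))"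
      unfolding c_def
      by (rule holomorphic_power_series[OF holomorphic_on_subset[OF assms(3) e(2)] w])
    from sums_Re[OF this] show ?thesis
      using ext[of "x + h"] w e(2) by (simp flip: of_real_power add: subset_iff)
  qed
  have "((\<lambda>n. Re (c n) * h ^ n) has_sum f (x + h)) UNIV" if h: "\<bar>h\<bar> < e" for h
  proof (rule norm_summable_imp_has_sum)
    obtain h' where h': "\<bar>h\<bar> < h'" "h' < e" using dense h by blast
    have "\<bar>h'\<bar> < e" using h' by linarith
    then have "summable (\<lambda>n. Re (c n) * h' ^ n)"
      using sums sums_summable by blast
    then show "summable (\<lambda>n. norm (Re (c n) * h ^ n))"
      by (rule powser_insidea) (use h' in auto)
  qed (rule sums[OF h])
  then show ?thesis unfolding power_series_at_def
    by (intro exI[of _ "\<lambda>n. Re (c n)"] exI[of _ e] conjI allI impI e(1))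
qed

lemma power_series_at_entire:
  assumes "g holomorphic_on UNIV" "\<And>y. g (of_real y) = of_real (f y)"
  shows "power_series_at f x"
  using power_series_at_holomorphic_extension[of UNIV x g f] assms by auto

text \<open>
  A holomorphic extension of the derivative has a primitive on a disc, and on the real diameter this
  primitive differs from the given function by a constant. In this way a function known only through
  its derivative is seen to be analytic.
\<close>

lemma power_series_at_primitive:
  fixes f f' :: "real \<Rightarrow> real" and g :: "complex \<Rightarrow> complex"
  assumes "open U" "of_real x \<in> U" "g holomorphic_on U"
    and ext: "\<And>y. of_real y \<in> U \<Longrightarrow> g (of_real y) = of_real (f' y)"
    and deriv: "\<And>y. (f has_real_derivative f' y) (at y)"
  shows "power_series_at f x"
proof -
  obtain e where e: "e > 0" "ball (of_real x) e \<subseteq> U"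
    using assms(1,2) open_contains_ball by blast
  obtain G where G: "\<And>w. w \<in> ball (of_real x) e \<Longrightarrow>
      (G has_field_derivative g w) (at w within ball (of_real x) e)"
    using holomorphic_convex_primitive'[OF convex_ball open_ball
        holomorphic_on_subset[OF assms(3) e(2)]] by blast
  have G': "(G has_field_derivative g w) (at w)" if "w \<in> ball (of_real x) e" for w
    using G[OF that] that by (metis at_within_open open_ball)
  have eq: "G (of_real y) - of_real (f y) = G (of_real x) - of_real (f x)"
    if "of_real y \<in> ball (of_real x :: complex) e" for y
  proof -
    obtain c where c: "\<And>s. s \<in> ball x e \<Longrightarrow> G (of_real s) - of_real (f s) = c"
    proof (rule has_vector_derivative_zero_constant[of "ball x e" "\<lambda>s. G (of_real s) - of_real (f s)"])
      fix s assume s: "s \<in> ball x e"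
      have s': "of_real s \<in> ball (of_real x :: complex) e"
        using s by (simp add: dist_norm flip: of_real_diff)
      have "((\<lambda>s. G (of_real s)) has_vector_derivative g (of_real s)) (at s)"
        by (rule has_vector_derivative_real_field[OF G'[OF s']])
      moreover have "((\<lambda>s. of_real (f s) :: complex) has_vector_derivative of_real (f' s)) (at s)"
        using has_vector_derivative_of_real[OF deriv[of s]] .
      ultimately have "((\<lambda>s. G (of_real s) - of_real (f s)) has_vector_derivative
          g (of_real s) - of_real (f' s)) (at s)"
        by (rule has_vector_derivative_diff)
      moreover have "g (of_real s) = of_real (f' s)"
        using ext[of s] s' e(2) by blast
      ultimately have "((\<lambda>s. G (of_real s) - of_real (f s)) has_vector_derivative 0) (at s)"
        by simp
      then show "((\<lambda>s. G (of_real s) - of_real (f s)) has_vector_derivative 0)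
          (at s within ball x e)"
        by (rule has_vector_derivative_at_within)
    qed auto
    moreover have "y \<in> ball x e" using that by (simp add: dist_norm flip: of_real_diff)
    moreover have "x \<in> ball x e" using e by simp
    ultimately show ?thesis by metis
  qed
  show ?thesis
  proof (rule power_series_at_holomorphic_extension)
    show "(\<lambda>w. G w - (G (of_real x) - of_real (f x))) holomorphic_on ball (of_real x) e"
      using G' by (intro holomorphic_intros)
        (metis field_differentiable_at_within field_differentiable_def holomorphic_onI)
    show "G (of_real y) - (G (of_real x) - of_real (f x)) = of_real (f y)"
      if "of_real y \<in> ball (of_real x :: complex) e" for y
      using eq[OF that] by (simp add: algebra_simps)
  qed (use e in auto)
qed

text \<open>
  The Cauchy product of two absolutely convergent series is a double series; pairs of natural numbers
  correspond to multi-indices on a two-element type. The components of all the surfaces below are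
  sums of products of this kind.
\<close>

lemma real_analytic_at_separated:
  fixes x :: "real ^ 2"
  assumes "power_series_at f (x $ 1)" "power_series_at g (x $ 2)"
  shows "real_analytic_at (\<lambda>y. f (y $ 1) * g (y $ 2)) x"
proof -
  obtain a d where a: "d > 0"
    "\<And>h. \<bar>h\<bar> < d \<Longrightarrow> ((\<lambda>n. a n * h ^ n) has_sum f (x $ 1 + h)) UNIV"
    using assms(1) unfolding power_series_at_def by blast
  obtain b e where b: "e > 0"
    "\<And>h. \<bar>h\<bar> < e \<Longrightarrow> ((\<lambda>n. b n * h ^ n) has_sum g (x $ 2 + h)) UNIV"
    using assms(2) unfolding power_series_at_def by blast
  define \<phi> where "\<phi> = (\<lambda>\<alpha> :: 2 \<Rightarrow> nat. (\<alpha> 1, \<alpha> 2))"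
  have bij: "bij_betw \<phi> UNIV (UNIV \<times> UNIV)"
  proof (rule bij_betwI[where g = "\<lambda>(m, n) i. if i = 1 then m else n"])
    show "(case \<phi> \<alpha> of (m, n) \<Rightarrow> \<lambda>i. if i = 1 then m else n) = \<alpha>" for \<alpha>
      unfolding \<phi>_def using exhaust_2 by (auto simp: fun_eq_iff)
  qed (auto simp: \<phi>_def)
  show ?thesis unfolding real_analytic_at_def
  proof (intro exI conjI allI impI)
    show "min d e > 0" using a b by simp
    fix h :: "real ^ 2" assume h: "norm h < min d e"
    have h1: "\<bar>h $ 1\<bar> < d" and h2: "\<bar>h $ 2\<bar> < e"
      using component_le_norm_cart[of h] h by (auto intro: le_less_trans)
    define p where "p m = a m * (h $ 1) ^ m" for m
    define q where "q n = b n * (h $ 2) ^ n" for n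
    have p: "(p has_sum f (x $ 1 + h $ 1)) UNIV" and q: "(q has_sum g (x $ 2 + h $ 2)) UNIV"
      using a(2)[OF h1] b(2)[OF h2] by (simp_all add: p_def [abs_def] q_def [abs_def])
    have abs_p: "(\<lambda>m. norm (p m)) summable_on UNIV" and abs_q: "(\<lambda>n. norm (q n)) summable_on UNIV"
      using p q summable_on_iff_abs_summable_on_real[of p] summable_on_iff_abs_summable_on_real[of q]
      by (auto simp: summable_on_def)
    have "((\<lambda>(m, n). p m * q n) has_sum f (x $ 1 + h $ 1) * g (x $ 2 + h $ 2)) (UNIV \<times> UNIV)"
    proof (rule has_sum_SigmaI)
      show "((\<lambda>n. case (m, n) of (m, n) \<Rightarrow> p m * q n) has_sum p m * g (x $ 2 + h $ 2)) UNIV" for m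
        using has_sum_cmult_right[OF q, of "p m"] by simp
      show "((\<lambda>m. p m * g (x $ 2 + h $ 2)) has_sum f (x $ 1 + h $ 1) * g (x $ 2 + h $ 2)) UNIV"
        by (rule has_sum_cmult_left[OF p])
      have "(\<lambda>x. norm (case x of (m, n) \<Rightarrow> p m * q n)) summable_on (UNIV \<times> UNIV)"
        unfolding Infinite_Sum.abs_summable_on_Sigma_iff
      proof (intro conjI ballI)
        show "(\<lambda>n. norm (case (m, n) of (m, n) \<Rightarrow> p m * q n)) summable_on UNIV" for m
          using summable_on_cmult_right[OF abs_q, of "\<bar>p m\<bar>"] by (simp add: abs_mult)
        show "(\<lambda>m. norm (\<Sum>\<^sub>\<infinity>n. norm (case (m, n) of (m, n) \<Rightarrow> p m * q n))) summable_on UNIV"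
          using summable_on_cmult_left[OF abs_p, of "\<bar>\<Sum>\<^sub>\<infinity>n. \<bar>q n\<bar>\<bar>"]
          by (simp add: abs_mult infsum_cmult_right')
      qed
      then show "(\<lambda>(m, n). p m * q n) summable_on (UNIV \<times> UNIV)"
        by (rule abs_summable_summable)
    qed
    then have "((\<lambda>\<alpha>. case \<phi> \<alpha> of (m, n) \<Rightarrow> p m * q n) has_sum
        f (x $ 1 + h $ 1) * g (x $ 2 + h $ 2)) UNIV"
      using has_sum_reindex_bij_betw[OF bij] by blast
    moreover have "(case \<phi> \<alpha> of (m, n) \<Rightarrow> p m * q n) =
        (\<Prod>i\<in>UNIV. (h $ i) ^ \<alpha> i) *\<^sub>R (a (\<alpha> 1) * b (\<alpha> 2))" for \<alpha>
      by (simp add: \<phi>_def p_def q_def UNIV_2)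
    ultimately show "((\<lambda>\<alpha>. (\<Prod>i\<in>UNIV. (h $ i) ^ \<alpha> i) *\<^sub>R (a (\<alpha> 1) * b (\<alpha> 2))) has_sum
        f ((x + h) $ 1) * g ((x + h) $ 2)) UNIV"
      by simp
  qed
qed

lemma real_analytic_at_const [simp]: "real_analytic_at (\<lambda>_. c) x"
  unfolding real_analytic_at_def
proof (intro exI conjI allI impI)
  fix h :: "real ^ 'a"
  have eq: "(\<lambda>\<alpha>. (\<Prod>i\<in>UNIV. (h $ i) ^ \<alpha> i) *\<^sub>R (if \<alpha> = (\<lambda>_. 0) then c else 0))
     = (\<lambda>\<alpha>. if \<alpha> = (\<lambda>_. 0) then c else 0)"
    by (auto simp: fun_eq_iff)
  show "((\<lambda>\<alpha>. (\<Prod>i\<in>UNIV. (h $ i) ^ \<alpha> i) *\<^sub>R (if \<alpha> = (\<lambda>_. 0) then c else 0)) has_sum c) UNIV"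
    unfolding eq by (rule has_sum_finite_neutralI[of "{\<lambda>_. 0}"]) auto
qed (rule zero_less_one)

lemma real_analytic_at_add:
  assumes "real_analytic_at f x" "real_analytic_at g x"
  shows "real_analytic_at (\<lambda>y. f y + g y) x"
proof -
  obtain a d where a: "d > 0" "\<And>h. norm h < d \<Longrightarrow>
      ((\<lambda>\<alpha>. (\<Prod>i\<in>UNIV. (h $ i) ^ \<alpha> i) *\<^sub>R a \<alpha>) has_sum f (x + h)) UNIV"
    using assms(1) unfolding real_analytic_at_def by blast
  obtain b e where b: "e > 0" "\<And>h. norm h < e \<Longrightarrow>
      ((\<lambda>\<alpha>. (\<Prod>i\<in>UNIV. (h $ i) ^ \<alpha> i) *\<^sub>R b \<alpha>) has_sum g (x + h)) UNIV"
    using assms(2) unfolding real_analytic_at_def by blast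
  show ?thesis unfolding real_analytic_at_def
  proof (intro exI[of _ "\<lambda>\<alpha>. a \<alpha> + b \<alpha>"] exI[of _ "min d e"] conjI allI impI)
    fix h :: "real ^ 'a" assume "norm h < min d e"
    then have "norm h < d" "norm h < e" by auto
    from has_sum_add[OF a(2)[OF this(1)] b(2)[OF this(2)]]
    show "((\<lambda>\<alpha>. (\<Prod>i\<in>UNIV. (h $ i) ^ \<alpha> i) *\<^sub>R (a \<alpha> + b \<alpha>)) has_sum
        f (x + h) + g (x + h)) UNIV"
      by (simp add: scaleR_add_right)
  qed (use a b in simp)
qed

lemma real_analytic_at_scaleR_left:
  assumes "real_analytic_at f x"
  shows "real_analytic_at (\<lambda>y. f y *\<^sub>R v) x"
proof -
  obtain a d where a: "d > 0" "\<And>h. norm h < d \<Longrightarrow>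
      ((\<lambda>\<alpha>. (\<Prod>i\<in>UNIV. (h $ i) ^ \<alpha> i) *\<^sub>R a \<alpha>) has_sum f (x + h)) UNIV"
    using assms unfolding real_analytic_at_def by blast
  have "((\<lambda>\<alpha>. (\<Prod>i\<in>UNIV. (h $ i) ^ \<alpha> i) *\<^sub>R (a \<alpha> *\<^sub>R v)) has_sum f (x + h) *\<^sub>R v) UNIV"
    if "norm h < d" for h
    using has_sum_bounded_linear[OF bounded_linear_scaleR_left a(2)[OF that], of v]
    by (simp add: o_def)
  then show ?thesis unfolding real_analytic_at_def
    by (intro exI[of _ "\<lambda>\<alpha>. a \<alpha> *\<^sub>R v"] exI[of _ d] conjI allI impI a(1))
qed

lemma real_analytic_at_sum:
  assumes "\<And>i. i \<in> I \<Longrightarrow> real_analytic_at (f i) x"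
  shows "real_analytic_at (\<lambda>y. \<Sum>i\<in>I. f i y) x"
  using assms
proof (induction I rule: infinite_finite_induct)
  case (insert i I)
  then show ?case by (simp add: real_analytic_at_add)
qed simp_all

lemma real_analytic_at_componentwise:
  fixes f :: "real ^ 'n \<Rightarrow> real ^ 'm"
  assumes "\<And>i. real_analytic_at (\<lambda>y. f y $ i) x"
  shows "real_analytic_at f x"
proof -
  have "f y = (\<Sum>i\<in>UNIV. f y $ i *\<^sub>R axis i 1)" for y
    using basis_expansion[of "f y"] by (simp add: scalar_mult_eq_scaleR)
  then have "f = (\<lambda>y. \<Sum>i\<in>UNIV. f y $ i *\<^sub>R axis i 1)" by blast
  moreover have "real_analytic_at (\<lambda>y. \<Sum>i\<in>UNIV. f y $ i *\<^sub>R (axis i 1 :: real ^ 'm)) x"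
    by (intro real_analytic_at_sum real_analytic_at_scaleR_left assms)
  ultimately show ?thesis by metis
qed

lemma real_analytic_at_cong:
  assumes "real_analytic_at f x" "e > 0" "\<And>h. norm h < e \<Longrightarrow> g (x + h) = f (x + h)"
  shows "real_analytic_at g x"
proof -
  obtain a d where a: "d > 0" "\<And>h. norm h < d \<Longrightarrow>
      ((\<lambda>\<alpha>. (\<Prod>i\<in>UNIV. (h $ i) ^ \<alpha> i) *\<^sub>R a \<alpha>) has_sum f (x + h)) UNIV"
    using assms(1) unfolding real_analytic_at_def by blast
  show ?thesis unfolding real_analytic_at_def
  proof (intro exI[of _ a] exI[of _ "min d e"] conjI allI impI)
    fix h :: "real ^ 'a" assume "norm h < min d e"
    then have "norm h < d" "norm h < e" by auto
    with a(2) assms(3)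
    show "((\<lambda>\<alpha>. (\<Prod>i\<in>UNIV. (h $ i) ^ \<alpha> i) *\<^sub>R a \<alpha>) has_sum g (x + h)) UNIV"
      by presburger
  qed (use a assms in simp)
qed

lemma real_analytic_at_translation:
  fixes x :: "real ^ 2"
  shows "real_analytic_at (\<lambda>y. y + v) x"
proof (rule real_analytic_at_componentwise)
  fix i :: 2
  have id: "power_series_at (\<lambda>y. y) t" and one: "power_series_at (\<lambda>_. 1) t" for t
    by (rule power_series_at_entire[where g = "\<lambda>w. w"], auto)
      (rule power_series_at_entire[where g = "\<lambda>w. 1"], auto)
  have "real_analytic_at (\<lambda>y :: real ^ 2. y $ 1) x" "real_analytic_at (\<lambda>y :: real ^ 2. y $ 2) x"
    using real_analytic_at_separated[OF id one, of x] real_analytic_at_separated[OF one id, of x]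
    by simp_all
  then show "real_analytic_at (\<lambda>y. (y + v) $ i) x"
    using exhaust_2[of i] by (auto intro!: real_analytic_at_add)
qed

section \<open>The torus as a quotient of the plane\<close>

definition torus_cover :: "real ^ 2 \<Rightarrow> complex \<times> complex" where
  "torus_cover x = (cis (x $ 1), cis (x $ 2))"

definition torus_space :: "(complex \<times> complex) topology" where
  "torus_space = top_of_set (sphere 0 1 \<times> sphere 0 1)"

definition period_cell :: "real ^ 2 \<Rightarrow> (real ^ 2) set" where
  "period_cell c = {x. \<bar>x $ 1 - c $ 1\<bar> < pi \<and> \<bar>x $ 2 - c $ 2\<bar> < pi}"

definition torus_chart :: "real ^ 2 \<Rightarrow> (complex \<times> complex) chart" where
  "torus_chart c = (torus_cover ` period_cell c,
     \<lambda>p. vector [c $ 1 + Arg (fst p * cis (- c $ 1)), c $ 2 + Arg (snd p * cis (- c $ 2))])"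

definition torus_atlas :: "(complex \<times> complex) chart set" where
  "torus_atlas = range torus_chart"

lemma cis_nonpos_Reals: "\<bar>y\<bar> < pi \<Longrightarrow> cis y \<notin> \<real>\<^sub>\<le>\<^sub>0"
proof
  assume y: "\<bar>y\<bar> < pi" and "cis y \<in> \<real>\<^sub>\<le>\<^sub>0"
  then have "sin y = 0" "cos y \<le> 0" by (auto simp: complex_nonpos_Reals_iff)
  with y have "y = 0"
    using sin_gt_zero[of y] sin_gt_zero[of "- y"] by (cases y "0 :: real" rule: linorder_cases) auto
  with \<open>cos y \<le> 0\<close> show False by simp
qed

lemma cis_Arg_unit: "norm v = 1 \<Longrightarrow> cis (Arg v) = v"
  using cis_Arg[of v] by (cases "v = 0") (auto simp: sgn_eq)

lemma torus_chart_cover: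
  assumes "x \<in> period_cell c"
  shows "chart_map (torus_chart c) (torus_cover x) = x"
proof -
  have "cis (x $ i) * cis (- c $ i) = cis (x $ i - c $ i)" for i
    by (simp add: cis_mult)
  moreover have "Arg (cis (x $ i - c $ i)) = x $ i - c $ i" if "i = 1 \<or> i = 2" for i
    using assms that by (intro Arg_cis) (auto simp: period_cell_def)
  ultimately show ?thesis
    by (simp add: torus_chart_def torus_cover_def vec_eq_iff forall_2)
qed

lemma chart_dom_torus_chart: "chart_dom (torus_chart c) = torus_cover ` period_cell c"
  by (simp add: torus_chart_def)

lemma chart_image_torus_chart:
  "chart_map (torus_chart c) ` chart_dom (torus_chart c) = period_cell c"
  unfolding chart_dom_torus_chart image_image by (simp add: torus_chart_cover)

lemma chart_inv_torus_chart:
  assumes "x \<in> period_cell c"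
  shows "chart_inv (torus_chart c) x = torus_cover x"
proof -
  have "inj_on (chart_map (torus_chart c)) (chart_dom (torus_chart c))"
    unfolding chart_dom_torus_chart by (rule inj_onI) (metis imageE torus_chart_cover)
  from inv_into_f_f[OF this, of "torus_cover x"] show ?thesis
    using assms by (simp add: chart_inv_def chart_dom_torus_chart torus_chart_cover)
qed

lemma open_period_cell: "open (period_cell c)"
  unfolding period_cell_def by (intro open_Collect_conj open_Collect_less continuous_intros)

lemma torus_cover_in_topspace [simp]: "torus_cover x \<in> sphere 0 1 \<times> sphere 0 1"
  by (simp add: torus_cover_def)

lemma chart_dom_torus_chart_eq:
  "chart_dom (torus_chart c) = (sphere 0 1 \<times> sphere 0 1) \<inter>
     {p. fst p * cis (- c $ 1) \<in> - \<real>\<^sub>\<le>\<^sub>0 \<and> snd p * cis (- c $ 2) \<in> - \<real>\<^sub>\<le>\<^sub>0}"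
    (is "_ = ?R")
proof (intro equalityI subsetI)
  fix p assume "p \<in> chart_dom (torus_chart c)"
  then obtain x where x: "x \<in> period_cell c" "p = torus_cover x"
    by (auto simp: chart_dom_torus_chart)
  then show "p \<in> ?R"
    using cis_nonpos_Reals by (auto simp: torus_cover_def cis_mult period_cell_def)
next
  fix p assume p: "p \<in> ?R"
  obtain u w where uw: "p = (u, w)" by (cases p)
  define x :: "real ^ 2" where
    "x = vector [c $ 1 + Arg (u * cis (- c $ 1)), c $ 2 + Arg (w * cis (- c $ 2))]"
  have *: "\<bar>Arg v\<bar> < pi \<and> cis (Arg v) = v" if "v \<notin> \<real>\<^sub>\<le>\<^sub>0" "norm v = 1" for v
  proof -
    have "cis (Arg v) = v" using that by (simp add: cis_Arg_unit)
    moreover have "Arg v \<noteq> pi"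
      using calculation that(1)
      by (metis cis_pi nonpos_Reals_of_real_iff of_real_1 of_real_minus neg_le_0_iff_le zero_le_one)
    ultimately show ?thesis using mpi_less_Arg[of v] Arg_le_pi[of v] by linarith
  qed
  have n: "norm (u * cis (- c $ 1)) = 1" "norm (w * cis (- c $ 2)) = 1"
    using p uw by (auto simp: norm_mult)
  have A: "\<bar>Arg (u * cis (- c $ 1))\<bar> < pi" "cis (Arg (u * cis (- c $ 1))) = u * cis (- c $ 1)"
     "\<bar>Arg (w * cis (- c $ 2))\<bar> < pi" "cis (Arg (w * cis (- c $ 2))) = w * cis (- c $ 2)"
    using p uw *[OF _ n(1)] *[OF _ n(2)] by auto
  have "x \<in> period_cell c" using A by (simp add: x_def period_cell_def)
  moreover have "torus_cover x = p"
  proof -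
    have "cis (c $ 1 + Arg (u * cis (- c $ 1))) = cis (c $ 1) * (u * cis (- c $ 1))"
      unfolding cis_mult[symmetric] A ..
    moreover have "cis (c $ 2 + Arg (w * cis (- c $ 2))) = cis (c $ 2) * (w * cis (- c $ 2))"
      unfolding cis_mult[symmetric] A ..
    ultimately show ?thesis by (simp add: torus_cover_def x_def uw mult.left_commute cis_mult)
  qed
  ultimately show "p \<in> chart_dom (torus_chart c)" by (auto simp: chart_dom_torus_chart)
qed

lemma is_chart_torus_chart: "is_chart torus_space (torus_chart c)"
  unfolding is_chart_def
proof (intro conjI)
  let ?D = "chart_dom (torus_chart c)"
  let ?V = "{p. fst p * cis (- c $ 1) \<in> - \<real>\<^sub>\<le>\<^sub>0 \<and> snd p * cis (- c $ 2) \<in> - \<real>\<^sub>\<le>\<^sub>0}"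
  have "?V = (\<lambda>p. fst p * cis (- c $ 1)) -` (- \<real>\<^sub>\<le>\<^sub>0)
      \<inter> (\<lambda>p. snd p * cis (- c $ 2)) -` (- \<real>\<^sub>\<le>\<^sub>0)"
    by auto
  then have "open ?V"
    by (auto intro!: open_Int open_vimage continuous_intros simp: open_Compl)
  then show "openin torus_space ?D"
    unfolding torus_space_def chart_dom_torus_chart_eq by (rule openin_open_Int)
  show "open (chart_map (torus_chart c) ` ?D)"
    unfolding chart_image_torus_chart by (rule open_period_cell)
  have sub: "subtopology torus_space ?D = top_of_set ?D"
    unfolding torus_space_def subtopology_subtopology chart_dom_torus_chart_eq
    by (simp add: Int_absorb1)
  have "homeomorphic_maps (top_of_set ?D) (top_of_set (period_cell c))
      (chart_map (torus_chart c)) torus_cover"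
    unfolding homeomorphic_maps_def continuous_map_subtopology_eu topspace_euclidean_subtopology
  proof (intro conjI ballI)
    have eq: "chart_map (torus_chart c) = (\<lambda>p. (c $ 1 + Arg (fst p * cis (- c $ 1))) *\<^sub>R axis 1 1
        + (c $ 2 + Arg (snd p * cis (- c $ 2))) *\<^sub>R axis 2 1)"
      by (simp add: torus_chart_def vec_eq_iff forall_2 axis_def fun_eq_iff)
    show "continuous_on ?D (chart_map (torus_chart c))"
      unfolding eq chart_dom_torus_chart_eq by (auto intro!: continuous_intros)
    show "chart_map (torus_chart c) \<in> ?D \<rightarrow> period_cell c"
      by (auto simp: chart_dom_torus_chart torus_chart_cover)
    show "continuous_on (period_cell c) torus_cover"
      unfolding torus_cover_def [abs_def] by (intro continuous_intros)
    show "torus_cover \<in> period_cell c \<rightarrow> ?D"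
      by (simp add: chart_dom_torus_chart)
    show "torus_cover (chart_map (torus_chart c) p) = p" if "p \<in> ?D" for p
      using that by (auto simp: chart_dom_torus_chart torus_chart_cover)
    show "chart_map (torus_chart c) (torus_cover x) = x" if "x \<in> period_cell c" for x
      using that by (rule torus_chart_cover)
  qed
  then show "homeomorphic_map (subtopology torus_space ?D)
      (top_of_set (chart_map (torus_chart c) ` ?D)) (chart_map (torus_chart c))"
    unfolding sub chart_image_torus_chart by (rule homeomorphic_maps_imp_map)
qed

text \<open>
  Two plane coordinates of the same point of the torus differ by a period, and the
  same period works for all nearby points. This gives both the analyticity of the atlas and its
  orientation.
\<close>

lemma torus_transition_locally_translation:
  assumes "x \<in> overlap (torus_chart c) (torus_chart d)"
  obtains e v where "e > 0"
    "\<And>h. norm h < e \<Longrightarrow> transition (torus_chart c) (torus_chart d) (x + h) = x + h + v"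
proof -
  obtain p where p: "p \<in> torus_cover ` period_cell c" "p \<in> torus_cover ` period_cell d"
      "x = chart_map (torus_chart c) p"
    using assms unfolding overlap_def chart_dom_torus_chart by blast
  obtain x' where x': "p = torus_cover x'" "x' \<in> period_cell c"
    using p(1) by (rule imageE)
  obtain y where y: "p = torus_cover y" "y \<in> period_cell d"
    using p(2) by (rule imageE)
  have "x = x'" using p(3) x' by (simp add: torus_chart_cover)
  then have x: "x \<in> period_cell c" "torus_cover x = torus_cover y"
    using x' y by simp_all
  obtain e1 where e1: "e1 > 0" "ball x e1 \<subseteq> period_cell c"
    using open_period_cell x(1) open_contains_ball by blast
  obtain e2 where e2: "e2 > 0" "ball y e2 \<subseteq> period_cell d"
    using open_period_cell y(2) open_contains_ball by blast
  show ?thesis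
  proof
    show "min e1 e2 > 0" using e1 e2 by simp
    fix h :: "real ^ 2" assume h: "norm h < min e1 e2"
    have "x + h \<in> period_cell c" "y + h \<in> period_cell d"
      using h e1 e2 by (auto simp: subset_iff dist_norm)
    moreover have "torus_cover (x + h) = torus_cover (y + h)"
      using x(2) by (simp add: torus_cover_def flip: cis_mult)
    ultimately show "transition (torus_chart c) (torus_chart d) (x + h) = x + h + (y - x)"
      by (simp add: transition_def chart_inv_torus_chart torus_chart_cover)
  qed
qed

lemma real_analytic_atlas_torus: "real_analytic_atlas torus_space torus_atlas"
  unfolding real_analytic_atlas_def
proof (intro conjI)
  show "\<forall>c\<in>torus_atlas. is_chart torus_space c"
    by (auto simp: torus_atlas_def is_chart_torus_chart)
  show "(\<Union>c\<in>torus_atlas. chart_dom c) = topspace torus_space"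
  proof (intro equalityI subsetI)
    fix p assume "p \<in> topspace torus_space"
    then have p: "norm (fst p) = 1" "norm (snd p) = 1" by (auto simp: torus_space_def)
    define x :: "real ^ 2" where "x = vector [Arg (fst p), Arg (snd p)]"
    have "torus_cover x = p" using p by (simp add: torus_cover_def x_def cis_Arg_unit prod_eq_iff)
    moreover have "x \<in> period_cell x" by (simp add: period_cell_def)
    ultimately show "p \<in> (\<Union>c\<in>torus_atlas. chart_dom c)"
      by (auto simp: torus_atlas_def chart_dom_torus_chart)
  qed (auto simp: torus_atlas_def chart_dom_torus_chart torus_space_def torus_cover_def)
  have "real_analytic_at (transition (torus_chart c) (torus_chart d)) x"
    if "x \<in> overlap (torus_chart c) (torus_chart d)" for c d x
  proof -
    from that obtain e v where "e > 0"
      "\<And>h. norm h < e \<Longrightarrow> transition (torus_chart c) (torus_chart d) (x + h) = x + h + v"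
      by (rule torus_transition_locally_translation) (rule that)
    then show ?thesis
      by (rule real_analytic_at_cong[OF real_analytic_at_translation])
  qed
  then show "\<forall>c\<in>torus_atlas. \<forall>d\<in>torus_atlas. real_analytic_on_open (transition c d) (overlap c d)"
    unfolding real_analytic_on_open_def torus_atlas_def by (intro ballI, elim rangeE, hypsubst)
qed

lemma oriented_torus_atlas: "oriented_atlas torus_atlas"
proof -
  have "det (jacobian (transition (torus_chart c) (torus_chart d)) (at x)) > 0"
    if "x \<in> overlap (torus_chart c) (torus_chart d)" for c d x
  proof -
    from that obtain e v where e: "e > 0"
        "\<And>h. norm h < e \<Longrightarrow> transition (torus_chart c) (torus_chart d) (x + h) = x + h + v"
      by (rule torus_transition_locally_translation) (rule that)
    let ?t = "transition (torus_chart c) (torus_chart d)"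
    have "((\<lambda>y. y + v) has_derivative (\<lambda>h. h)) (at x)" by (auto intro!: derivative_eq_intros)
    then have "(?t has_derivative (\<lambda>h. h)) (at x)"
    proof (rule has_derivative_transform_within[OF _ e(1)])
      show "y + v = ?t y" if "dist y x < e" for y
        using e(2)[of "y - x"] that by (simp add: dist_norm)
    qed simp
    then have "frechet_derivative ?t (at x) = (\<lambda>h. h)"
      by (rule frechet_derivative_at[symmetric])
    then show ?thesis
      by (simp add: jacobian_def matrix_id_mat_1[unfolded id_def])
  qed
  then show ?thesis
    unfolding oriented_atlas_def torus_atlas_def by (intro ballI, elim rangeE, hypsubst)
qed

lemma second_countable_euclidean:
  "second_countable (euclidean :: 'a::second_countable_topology topology)"
proof -
  obtain B :: "'a set set" where B: "countable B" "\<And>C. C \<in> B \<Longrightarrow> open C"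
    "\<And>S. open S \<Longrightarrow> \<exists>U. U \<subseteq> B \<and> S = \<Union>U"
    by (rule univ_second_countable) (rule that)
  show ?thesis unfolding second_countable_def open_openin[symmetric]
  proof (rule exI[of _ B], intro conjI allI impI ballI)
    fix U and x :: 'a assume U: "open U \<and> x \<in> U"
    obtain C where "C \<subseteq> B" "U = \<Union>C" using B(3)[OF conjunct1[OF U]] by (elim exE conjE)
    with U show "\<exists>V\<in>B. x \<in> V \<and> V \<subseteq> U" by blast
  qed (use B(1,2) in simp_all)
qed

lemma real_analytic_torus_torus_space: "real_analytic_torus torus_space torus_atlas"
  unfolding real_analytic_torus_def
proof (intro conjI)
  show "real_analytic_surface torus_space torus_atlas"
    unfolding real_analytic_surface_def
  proof (intro conjI)
    show "Hausdorff_space torus_space"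
      unfolding torus_space_def by (intro Hausdorff_space_subtopology Hausdorff_space_euclidean)
    show "second_countable torus_space"
      unfolding torus_space_def by (intro second_countable_subtopology second_countable_euclidean)
  qed (rule real_analytic_atlas_torus)
  have "compact (sphere 0 1 \<times> sphere 0 1 :: (complex \<times> complex) set)"
    by (intro compact_Times compact_sphere)
  then show "compact_space torus_space"
    unfolding torus_space_def
    by (intro compact_space_subtopology) (simp add: compactin_euclidean_iff)
  have "connected (sphere 0 1 \<times> sphere 0 1 :: (complex \<times> complex) set)"
    by (rule connected_Times; rule connected_sphere; simp)
  then show "connected_space torus_space"
    unfolding torus_space_def connectedin_iff_connected[symmetric] connectedin_def by (rule conjunct2)
  show "orientable_surface torus_space torus_atlas"
    unfolding orientable_surface_def
    using real_analytic_atlas_torus oriented_torus_atlas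
    by (intro exI[of _ torus_atlas] conjI) simp_all
  show "genus_one torus_space"
    unfolding genus_one_def torus_space_def prod_topology_subtopology_eu
    by (rule homeomorphic_space_refl)
qed

section \<open>Maps on the torus given by doubly periodic maps\<close>

text \<open>
  The principal arguments pick one preimage of a point under the covering; for a doubly periodic map
  every preimage gives the same value.
\<close>

definition from_cover :: "(real ^ 2 \<Rightarrow> 'b) \<Rightarrow> complex \<times> complex \<Rightarrow> 'b" where
  "from_cover F p = F (vector [Arg (fst p), Arg (snd p)])"

definition doubly_periodic :: "(real ^ 2 \<Rightarrow> 'b) \<Rightarrow> bool" where
  "doubly_periodic F \<longleftrightarrow> (\<forall>x y. torus_cover x = torus_cover y \<longrightarrow> F x = F y)"

lemma from_cover_torus_cover:
  assumes "doubly_periodic F"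
  shows "from_cover F (torus_cover x) = F x"
proof -
  have "torus_cover (vector [Arg (fst (torus_cover x)), Arg (snd (torus_cover x))]) = torus_cover x"
    by (simp add: torus_cover_def cis_Arg_unit)
  then show ?thesis using assms unfolding doubly_periodic_def from_cover_def by blast
qed

lemma from_cover_in_chart:
  assumes "doubly_periodic F" "x \<in> period_cell c"
  obtains e where "e > 0"
    "\<And>h. norm h < e \<Longrightarrow> (from_cover F \<circ> chart_inv (torus_chart c)) (x + h) = F (x + h)"
proof -
  obtain e where e: "e > 0" "ball x e \<subseteq> period_cell c"
    using open_period_cell assms(2) open_contains_ball by blast
  show ?thesis
  proof
    fix h :: "real ^ 2" assume "norm h < e"
    then have "x + h \<in> period_cell c" using e(2) by (auto simp: subset_iff dist_norm)
    then show "(from_cover F \<circ> chart_inv (torus_chart c)) (x + h) = F (x + h)"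
      using assms(1) by (simp add: chart_inv_torus_chart from_cover_torus_cover)
  qed (rule e(1))
qed

lemma chart_deriv_from_cover:
  assumes "doubly_periodic F" "x \<in> period_cell c" "(F has_derivative F') (at x)"
  shows "chart_deriv (from_cover F) (torus_chart c) (torus_cover x) = F'"
proof -
  obtain e where e: "e > 0"
    "\<And>h. norm h < e \<Longrightarrow> (from_cover F \<circ> chart_inv (torus_chart c)) (x + h) = F (x + h)"
    using from_cover_in_chart[OF assms(1,2)] by blast
  have "((from_cover F \<circ> chart_inv (torus_chart c)) has_derivative F') (at x)"
  proof (rule has_derivative_transform_within[OF assms(3) e(1)])
    show "F y = (from_cover F \<circ> chart_inv (torus_chart c)) y" if "dist y x < e" for y
      using e(2)[of "y - x"] that by (simp add: dist_norm)
  qed simp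
  then show ?thesis
    unfolding chart_deriv_def torus_chart_cover[OF assms(2)]
    by (rule frechet_derivative_at[symmetric])
qed

lemma real_analytic_immersion_from_cover:
  assumes "doubly_periodic F" "\<And>x. real_analytic_at F x"
    "\<And>x. (F has_derivative F' x) (at x)" "\<And>x. inj (F' x)"
  shows "real_analytic_immersion torus_atlas (from_cover F)"
  unfolding real_analytic_immersion_def torus_atlas_def
proof (intro ballI, elim rangeE, hypsubst, intro conjI ballI)
  fix c
  show "real_analytic_on_open (from_cover F \<circ> chart_inv (torus_chart c))
      (chart_map (torus_chart c) ` chart_dom (torus_chart c))"
    unfolding real_analytic_on_open_def chart_image_torus_chart
  proof
    fix x assume "x \<in> period_cell c"
    then obtain e where "e > 0"
      "\<And>h. norm h < e \<Longrightarrow> (from_cover F \<circ> chart_inv (torus_chart c)) (x + h) = F (x + h)"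
      using from_cover_in_chart[OF assms(1)] by blast
    then show "real_analytic_at (from_cover F \<circ> chart_inv (torus_chart c)) x"
      by (rule real_analytic_at_cong[OF assms(2)])
  qed
  fix p assume "p \<in> chart_dom (torus_chart c)"
  then show "inj (chart_deriv (from_cover F) (torus_chart c) p)"
    using assms(4) chart_deriv_from_cover[OF assms(1) _ assms(3)]
    by (auto simp: chart_dom_torus_chart)
qed

lemma same_induced_metric_from_cover:
  assumes "doubly_periodic F" "doubly_periodic G"
    "\<And>x. (F has_derivative F' x) (at x)" "\<And>x. (G has_derivative G' x) (at x)"
    "\<And>x v w. F' x v \<bullet> F' x w = G' x v \<bullet> G' x w"
  shows "same_induced_metric torus_atlas (from_cover F) (from_cover G)"
  unfolding same_induced_metric_def torus_atlas_def induced_metric_def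
  using assms(5) chart_deriv_from_cover[OF assms(1) _ assms(3)] chart_deriv_from_cover[OF assms(2) _ assms(4)]
  by (auto simp: chart_dom_torus_chart)

text \<open>
  If the points \<open>x0\<close> and \<open>x0 + w\<close> have opposite images under \<open>G\<close>, these images have distance twice
  the norm of \<open>G x0\<close>. A congruence would turn them into two points of the other surface at the same
  distance, but that surface lies in a ball around the origin of diameter less than this distance.
\<close>

lemma not_related_from_cover:
  fixes F G :: "real ^ 2 \<Rightarrow> 'b::euclidean_space"
  assumes "doubly_periodic F" "doubly_periodic G"
    and sym: "G (x0 + w) = - G x0"
    and far: "\<And>x. norm (F x) < norm (G x0)"
  shows "\<not> related_by_ambient_isometry torus_space torus_atlas (from_cover F) (from_cover G)"
proof
  assume "related_by_ambient_isometry torus_space torus_atlas (from_cover F) (from_cover G)"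
  then obtain I h where I: "ambient_isometry I" and
    rel: "\<And>p. p \<in> topspace torus_space \<Longrightarrow> from_cover G p = I (from_cover F (h p))"
    unfolding related_by_ambient_isometry_def by blast
  have top: "torus_cover x \<in> topspace torus_space" for x by (simp add: torus_space_def)
  have bound: "norm (from_cover F p) < norm (G x0)" for p
    by (simp add: from_cover_def far)
  let ?p = "h (torus_cover x0)" and ?q = "h (torus_cover (x0 + w))"
  have "2 * norm (G x0) = dist (G x0) (G (x0 + w))"
    by (simp add: sym dist_norm flip: scaleR_2)
  also have "\<dots> = dist (from_cover F ?p) (from_cover F ?q)"
    using I rel[OF top] assms(2) by (metis ambient_isometry_def from_cover_torus_cover)
  also have "\<dots> \<le> norm (from_cover F ?p) + norm (from_cover F ?q)"
    by (rule dist_triangle_le[of _ 0]) simp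
  also have "\<dots> < 2 * norm (G x0)" using bound[of ?p] bound[of ?q] by linarith
  finally show False by simp
qed

section \<open>Periodic functions, compactness and derivatives\<close>

lemma periodic_int_multiple:
  fixes f :: "real \<Rightarrow> 'b"
  assumes "\<And>t. f (t + p) = f t"
  shows "f (t + p * of_int n) = f t"
proof -
  have nat: "f (t + p * of_nat k) = f t" for t k
  proof (induction k)
    case (Suc k)
    then show ?case using assms[of "t + p * of_nat k"] by (simp add: algebra_simps)
  qed simp
  show ?thesis
  proof (cases n)
    case (nonneg k)
    then show ?thesis using nat[of t k] by simp
  next
    case (neg k)
    then have "real_of_int n = - real (Suc k)" by simp
    then have "t + p * of_int n + p * of_nat (Suc k) = t" by algebra
    then show ?thesis using nat[of "t + p * of_int n" "Suc k"] by metis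
  qed
qed

lemma cis_eq_imp_periodic_eq:
  fixes f :: "real \<Rightarrow> 'b"
  assumes "\<And>t. f (t + 2 * pi) = f t" "cis a = cis b"
  shows "f a = f b"
proof -
  have "sin a = sin b \<and> cos a = cos b" using assms(2) by (simp add: complex_eq_iff)
  then obtain n :: int where "a = b + 2 * pi * n" using sin_cos_eq_iff by blast
  then show ?thesis using periodic_int_multiple[of f "2 * pi" b n] assms(1) by simp
qed

lemma periodic_Arg_cis:
  fixes f :: "real \<Rightarrow> 'b"
  assumes "\<And>t. f (t + 2 * pi) = f t"
  shows "f (Arg (cis t)) = f t"
  by (rule cis_eq_imp_periodic_eq[of f, OF assms]) (simp add: cis_Arg_unit)

lemma Arg_in_interval: "Arg w \<in> {- pi..pi}"
  using mpi_less_Arg[of w] Arg_le_pi[of w] by simp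

lemma periodic_bounded:
  fixes f :: "real \<Rightarrow> real"
  assumes "continuous_on UNIV f" "\<And>t. f (t + 2 * pi) = f t"
  obtains K where "K > 0" "\<And>t. \<bar>f t\<bar> \<le> K"
proof -
  have "compact (f ` {- pi..pi})"
    by (intro compact_continuous_image continuous_on_subset[OF assms(1)]) auto
  then have "bounded (f ` {- pi..pi})" by (rule compact_imp_bounded)
  then obtain K where K: "K > 0" "\<And>t. t \<in> {- pi..pi} \<Longrightarrow> \<bar>f t\<bar> \<le> K"
    unfolding bounded_pos by auto
  show ?thesis
    using that[OF K(1)] K(2)[OF Arg_in_interval] periodic_Arg_cis[of f, OF assms(2)] by metis
qed

lemma periodic_bounded_below:
  fixes f :: "real \<Rightarrow> real"
  assumes "continuous_on UNIV f" "\<And>t. f (t + 2 * pi) = f t" "\<And>t. f t > 0"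
  obtains m where "m > 0" "\<And>t. f t \<ge> m"
proof -
  have "continuous_on {- pi..pi} f" by (rule continuous_on_subset[OF assms(1)]) auto
  then have "\<exists>a\<in>{- pi..pi}. \<forall>t\<in>{- pi..pi}. f a \<le> f t"
    by (intro continuous_attains_inf) auto
  then obtain a where a: "\<And>t. t \<in> {- pi..pi} \<Longrightarrow> f a \<le> f t"
    by blast
  show ?thesis
    using that[OF assms(3)[of a]] a[OF Arg_in_interval] periodic_Arg_cis[of f, OF assms(2)] by metis
qed

lemma shifted_derivative:
  fixes f f' :: "real \<Rightarrow> real"
  assumes "\<And>t. f (t + p) = c * f t" "\<And>t. (f has_real_derivative f' t) (at t)"
  shows "f' (t + p) = c * f' t"
proof (rule DERIV_unique)
  show "((\<lambda>t. f (t + p)) has_real_derivative f' (t + p)) (at t)"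
    using assms(2)[of "t + p"] by (simp add: DERIV_shift)
  show "((\<lambda>t. f (t + p)) has_real_derivative c * f' t) (at t)"
    unfolding assms(1) by (rule DERIV_cmult[OF assms(2)])
qed

text \<open>
  Where \<open>g\<close> is positive, the term \<open>L\<^sup>2 * g x\<close> pushes the value down as \<open>L\<close> grows, so in the limit only
  the zeros of \<open>g\<close> count. For \<open>L = 1, 2, 3, \<dots>\<close> a sequence of counterexamples would accumulate at a zero
  of \<open>g\<close> at which \<open>P\<close> is at least \<open>K\<close>.
\<close>

lemma stretched_below_threshold:
  fixes g P R :: "'a::metric_space \<Rightarrow> real"
  assumes X: "compact X" and cont: "continuous_on X g" "continuous_on X P" "continuous_on X R"
    and g: "\<And>x. x \<in> X \<Longrightarrow> g x \<ge> 0" and P: "\<And>x. x \<in> X \<Longrightarrow> g x = 0 \<Longrightarrow> P x < K"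
  shows "\<exists>L\<ge>1. \<forall>x\<in>X. P x - L\<^sup>2 * g x + R x / L\<^sup>2 < K"
proof (rule ccontr)
  assume "\<not> ?thesis"
  then have "\<forall>n. \<exists>x\<in>X. P x - (real (Suc n))\<^sup>2 * g x + R x / (real (Suc n))\<^sup>2 \<ge> K"
    by (metis not_less of_nat_Suc le_add_same_cancel2 of_nat_0_le_iff add.commute)
  then obtain u where u: "\<And>n. u n \<in> X"
    "\<And>n. P (u n) - (real (Suc n))\<^sup>2 * g (u n) + R (u n) / (real (Suc n))\<^sup>2 \<ge> K"
    by metis
  obtain l k where l: "l \<in> X" "strict_mono k" "(u \<circ> k) \<longlonglongrightarrow> l"
    using X u(1) unfolding compact_def by metis
  have lim: "(\<lambda>n. f (u (k n))) \<longlonglongrightarrow> f l" if "continuous_on X f" for f :: "'a \<Rightarrow> real"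
    using continuous_on_tendsto_compose[OF that l(3)] l(1) u(1) by (simp add: o_def)
  have "LIM n sequentially. real (Suc (k n)) :> at_top"
    using filterlim_compose[OF filterlim_real_sequentially
        filterlim_compose[OF filterlim_Suc filterlim_subseq[OF l(2)]]] by simp
  then have "(\<lambda>n. inverse (real (Suc (k n)))) \<longlonglongrightarrow> 0"
    by (rule tendsto_inverse_0_at_top)
  then have inv: "(\<lambda>n. (inverse (real (Suc (k n))))\<^sup>2) \<longlonglongrightarrow> 0"
    by (metis tendsto_power zero_power2)
  define i where "i n = (inverse (real (Suc (k n))))\<^sup>2" for n
  have i: "i n > 0" "i n * (real (Suc (k n)))\<^sup>2 = 1" for n
    unfolding i_def by (simp_all add: power_mult_distrib[symmetric] del: of_nat_Suc)
  have i_lim: "i \<longlonglongrightarrow> 0" using inv by (simp add: i_def[abs_def])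
  have key: "P (u (k n)) - (real (Suc (k n)))\<^sup>2 * g (u (k n)) + R (u (k n)) * i n \<ge> K" for n
    using u(2)[of "k n"] by (simp add: i_def power_inverse divide_inverse del: of_nat_Suc)
  have le: "K \<le> P (u (k n)) + R (u (k n)) * i n" for n
    using key[of n] mult_nonneg_nonneg[OF zero_le_power2[of "real (Suc (k n))"] g[OF u(1), of "k n"]]
    by linarith
  have "(\<lambda>n. P (u (k n)) + R (u (k n)) * i n) \<longlonglongrightarrow> P l + R l * 0"
    by (intro tendsto_add tendsto_mult lim cont i_lim)
  then have "K \<le> P l + R l * 0"
    by (rule LIMSEQ_le_const) (use le in blast)
  moreover have "g l \<le> 0"
  proof (rule LIMSEQ_le[OF lim[OF cont(1)]])
    have "(\<lambda>n. i n * (P (u (k n)) + R (u (k n)) * i n - K)) \<longlonglongrightarrow> 0 * (P l + R l * 0 - K)"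
      by (intro tendsto_diff tendsto_add tendsto_mult tendsto_const lim cont i_lim)
    then show "(\<lambda>n. i n * (P (u (k n)) + R (u (k n)) * i n - K)) \<longlonglongrightarrow> 0" by simp
    show "\<exists>N. \<forall>n\<ge>N. g (u (k n)) \<le> i n * (P (u (k n)) + R (u (k n)) * i n - K)"
    proof (intro exI allI impI)
      fix n
      have "i n * ((real (Suc (k n)))\<^sup>2 * g (u (k n))) \<le> i n * (P (u (k n)) + R (u (k n)) * i n - K)"
        using key[of n] i(1)[of n] by (intro mult_left_mono) auto
      then show "g (u (k n)) \<le> i n * (P (u (k n)) + R (u (k n)) * i n - K)"
        using i(2)[of n] by (metis mult.assoc mult_1)
    qed
  qed
  ultimately show False using P[OF l(1)] g[OF l(1)] by simp
qed

lemma has_derivative_separated: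
  fixes x :: "real ^ 2" and a b :: "real \<Rightarrow> real"
  assumes "(a has_real_derivative a') (at (x $ 1))" "(b has_real_derivative b') (at (x $ 2))"
  shows "((\<lambda>x. a (x $ 1) * b (x $ 2)) has_derivative
    (\<lambda>v. v $ 1 * (a' * b (x $ 2)) + v $ 2 * (a (x $ 1) * b'))) (at x)"
proof -
  have nth: "((\<lambda>x :: real ^ 2. x $ i) has_derivative (\<lambda>v. v $ i)) (at x)" for i
    by (rule bounded_linear.has_derivative[OF bounded_linear_vec_nth has_derivative_ident])
  have "((\<lambda>x :: real ^ 2. a (x $ 1)) has_derivative (\<lambda>v. a' * v $ 1)) (at x)"
    using has_derivative_compose[OF nth has_field_derivative_imp_has_derivative[OF assms(1)]] by simp
  moreover have "((\<lambda>x :: real ^ 2. b (x $ 2)) has_derivative (\<lambda>v. b' * v $ 2)) (at x)"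
    using has_derivative_compose[OF nth has_field_derivative_imp_has_derivative[OF assms(2)]] by simp
  ultimately show ?thesis
    by (rule has_derivative_eq_rhs[OF has_derivative_mult]) (simp add: fun_eq_iff algebra_simps)
qed

lemma has_derivative_vector3:
  fixes f1 f2 f3 :: "'a::real_normed_vector \<Rightarrow> real"
  assumes "(f1 has_derivative f1') F" "(f2 has_derivative f2') F" "(f3 has_derivative f3') F"
  shows "((\<lambda>x. vector [f1 x, f2 x, f3 x] :: real ^ 3) has_derivative
     (\<lambda>v. vector [f1' v, f2' v, f3' v])) F"
proof -
  have eq: "vector [a, b, c] = a *\<^sub>R axis 1 1 + b *\<^sub>R axis 2 1 + c *\<^sub>R (axis 3 1 :: real ^ 3)"
    for a b c :: real
    by (simp add: vec_eq_iff forall_3 axis_def)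
  show ?thesis unfolding eq
    by (intro has_derivative_add has_derivative_scaleR_left assms)
qed

section \<open>Bending a surface of revolution\<close>

text \<open>
  The horizontal part of the bending is \<open>\<tau>\<close> times the vector with radial component
  \<open>- (4 / 3) cos 4p\<close> and tangential component \<open>sin 4p\<close> in the frame rotated by \<open>3 p\<close>; the definitions
  give its Cartesian components. The frequency \<open>4 / 3\<close> has an even numerator and an odd denominator,
  which makes the horizontal part change its sign under \<open>p \<mapsto> p + \<pi>\<close>, as that of the surface does.
\<close>

definition bend_x :: "real \<Rightarrow> real" where
  "bend_x p = - (4 / 3) * cos (4 * p) * cos (3 * p) - sin (4 * p) * sin (3 * p)"

definition bend_y :: "real \<Rightarrow> real" where
  "bend_y p = - (4 / 3) * cos (4 * p) * sin (3 * p) + sin (4 * p) * cos (3 * p)"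

lemma bend_x_deriv: "(bend_x has_real_derivative 7 / 3 * sin (4 * p) * cos (3 * p)) (at p)"
  unfolding bend_x_def [abs_def] by (auto intro!: derivative_eq_intros simp: field_simps)

lemma bend_y_deriv: "(bend_y has_real_derivative 7 / 3 * sin (4 * p) * sin (3 * p)) (at p)"
  unfolding bend_y_def [abs_def] by (auto intro!: derivative_eq_intros simp: field_simps)

lemma bend_components:
  "cos (3 * p) * bend_x p + sin (3 * p) * bend_y p = - (4 / 3) * cos (4 * p)"
  "cos (3 * p) * bend_y p - sin (3 * p) * bend_x p = sin (4 * p)"
proof -
  have "(cos (3 * p))\<^sup>2 + (sin (3 * p))\<^sup>2 = 1" by simp
  then show "cos (3 * p) * bend_x p + sin (3 * p) * bend_y p = - (4 / 3) * cos (4 * p)"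
     "cos (3 * p) * bend_y p - sin (3 * p) * bend_x p = sin (4 * p)"
    unfolding bend_x_def bend_y_def by algebra+
qed

lemma abs_cos_mult_le: "\<bar>a\<bar> \<le> b \<Longrightarrow> \<bar>a * cos t\<bar> \<le> b" for a b t :: real
  using mult_mono[of "\<bar>a\<bar>" b "\<bar>cos t\<bar>" 1] by (simp add: abs_mult)

lemma abs_sin_mult_le: "\<bar>a\<bar> \<le> b \<Longrightarrow> \<bar>a * sin t\<bar> \<le> b" for a b t :: real
  using mult_mono[of "\<bar>a\<bar>" b "\<bar>sin t\<bar>" 1] by (simp add: abs_mult)

lemma bend_bounds:
  "\<bar>bend_x p\<bar> \<le> 7 / 3" "\<bar>bend_y p\<bar> \<le> 7 / 3"
  "\<bar>7 / 3 * sin (4 * p) * cos (3 * p)\<bar> \<le> 7 / 3"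
  "\<bar>7 / 3 * sin (4 * p) * sin (3 * p)\<bar> \<le> 7 / 3"
proof -
  have 1: "\<bar>- (4 / 3) * cos (4 * p) * cos (3 * p)\<bar> \<le> 4 / 3"
    "\<bar>- (4 / 3) * cos (4 * p) * sin (3 * p)\<bar> \<le> 4 / 3"
    "\<bar>sin (4 * p) * sin (3 * p)\<bar> \<le> 1" "\<bar>sin (4 * p) * cos (3 * p)\<bar> \<le> 1"
    by (intro abs_cos_mult_le abs_sin_mult_le; simp)+
  show "\<bar>bend_x p\<bar> \<le> 7 / 3" "\<bar>bend_y p\<bar> \<le> 7 / 3"
    using 1 unfolding bend_x_def bend_y_def by linarith+
  show "\<bar>7 / 3 * sin (4 * p) * cos (3 * p)\<bar> \<le> 7 / 3"
    "\<bar>7 / 3 * sin (4 * p) * sin (3 * p)\<bar> \<le> 7 / 3"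
    by (intro abs_cos_mult_le abs_sin_mult_le; simp)+
qed

lemma continuous_on_bend [continuous_intros]:
  fixes f :: "'a::t2_space \<Rightarrow> real"
  assumes "continuous_on S f"
  shows "continuous_on S (\<lambda>x. bend_x (f x))" "continuous_on S (\<lambda>x. bend_y (f x))"
  unfolding bend_x_def bend_y_def by (intro continuous_intros assms)+

lemma sin_cos_multiple_shift:
  "cos (3 * (p + pi)) = - cos (3 * p)" "sin (3 * (p + pi)) = - sin (3 * p)"
  "cos (4 * (p + pi)) = cos (4 * p)" "sin (4 * (p + pi)) = sin (4 * p)"
proof -
  have 3: "3 * (p + pi) = (3 * p + pi) + 2 * pi" and 4: "4 * (p + pi) = (4 * p + 2 * pi) + 2 * pi"
    by simp_all
  show "cos (3 * (p + pi)) = - cos (3 * p)" "sin (3 * (p + pi)) = - sin (3 * p)"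
    unfolding 3 sin_periodic cos_periodic by simp_all
  show "cos (4 * (p + pi)) = cos (4 * p)" "sin (4 * (p + pi)) = sin (4 * p)"
    unfolding 4 sin_periodic cos_periodic by simp_all
qed

lemma bend_shift: "bend_x (p + pi) = - bend_x p" "bend_y (p + pi) = - bend_y p"
  unfolding bend_x_def bend_y_def sin_cos_multiple_shift by simp_all

text \<open>
  The equations \<open>bending\<close> say that the surface of revolution with profile \<open>(r, z)\<close> admits the
  infinitesimal bending with \<open>\<tau> = sin\<^sup>2 t\<close> and vertical component \<open>\<zeta> cos 4p\<close>. In terms of \<open>z\<close> as
  independent variable they amount to \<open>r \<tau>'' + (n\<^sup>2 - 1) \<tau> r'' = 0\<close> with \<open>n = 4 / 3\<close>. At an extremum of \<open>z\<close> where
  \<open>r'\<close> does not vanish they force \<open>\<tau>\<close> to have a double zero; the two tips of the profile at \<open>t = 0\<close>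
  and \<open>t = \<pi>\<close> are the zeros of \<open>sin\<^sup>2 t\<close>. The assumptions \<open>top\<close> say that \<open>|z|\<close> is maximal only at the
  tips, and nondegenerately so.
\<close>

locale flexible_profile =
  fixes r z \<zeta> r' z' \<zeta>' :: "real \<Rightarrow> real" and \<kappa> :: real
  assumes r_deriv: "(r has_real_derivative r' t) (at t)"
    and z_deriv: "(z has_real_derivative z' t) (at t)"
    and \<zeta>_deriv: "(\<zeta> has_real_derivative \<zeta>' t) (at t)"
    and cont': "continuous_on UNIV r'" "continuous_on UNIV z'" "continuous_on UNIV \<zeta>'"
    and analytic: "power_series_at r t" "power_series_at z t" "power_series_at \<zeta> t"
    and shift: "r (t + pi) = r t" "z (t + pi) = - z t" "\<zeta> (t + pi) = - \<zeta> t"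
    and r_pos: "r t > 0"
    and regular: "r' t \<noteq> 0 \<or> z' t \<noteq> 0"
    and bending: "z' t * \<zeta>' t = 8 / 3 * (r' t * sin t * cos t)"
      "4 * (z' t * \<zeta> t) = 6 * (r t * sin t * cos t) + 7 / 3 * (r' t * (sin t)\<^sup>2)"
    and z0_neg: "z 0 < 0" and \<zeta>0_pos: "\<zeta> 0 > 0"
    and top: "\<kappa> > 0" "\<bar>z t\<bar> \<le> - z 0 - \<kappa> * (sin t)\<^sup>2"
begin

text \<open>
  The surfaces \<open>A + s B\<close>, for \<open>s = 1\<close> and \<open>s = - 1\<close>, where \<open>A = (x, y, L z) + e L (e\<^sub>1 \<times> k)\<close>,
  \<open>B = e k\<close> and \<open>k = (h\<^sub>x, h\<^sub>y, h\<^sub>z / L)\<close> is the bending of the stretched surface. Every component is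
  written as a sum of products of a function of \<open>t\<close> and a function of \<open>p\<close>.
\<close>

definition bent :: "real \<Rightarrow> real \<Rightarrow> real \<Rightarrow> real ^ 2 \<Rightarrow> real ^ 3" where
  "bent e L s x = vector
    [r (x $ 1) * cos (3 * x $ 2) + (sin (x $ 1))\<^sup>2 * (s * e * bend_x (x $ 2)),
     r (x $ 1) * sin (3 * x $ 2) + (sin (x $ 1))\<^sup>2 * (s * e * bend_y (x $ 2))
       + \<zeta> (x $ 1) * (- e * cos (4 * x $ 2)),
     z (x $ 1) * L + (sin (x $ 1))\<^sup>2 * (L * e * bend_y (x $ 2))
       + \<zeta> (x $ 1) * (s * e / L * cos (4 * x $ 2))]"

definition bent_t :: "real \<Rightarrow> real \<Rightarrow> real \<Rightarrow> real \<Rightarrow> real \<Rightarrow> real ^ 3" where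
  "bent_t e L s t p = vector
    [r' t * cos (3 * p) + 2 * sin t * cos t * (s * e * bend_x p),
     r' t * sin (3 * p) + 2 * sin t * cos t * (s * e * bend_y p) + \<zeta>' t * (- e * cos (4 * p)),
     z' t * L + 2 * sin t * cos t * (L * e * bend_y p) + \<zeta>' t * (s * e / L * cos (4 * p))]"

definition bent_p :: "real \<Rightarrow> real \<Rightarrow> real \<Rightarrow> real \<Rightarrow> real \<Rightarrow> real ^ 3" where
  "bent_p e L s t p = vector
    [r t * (- 3 * sin (3 * p)) + (sin t)\<^sup>2 * (s * e * (7 / 3 * sin (4 * p) * cos (3 * p))),
     r t * (3 * cos (3 * p)) + (sin t)\<^sup>2 * (s * e * (7 / 3 * sin (4 * p) * sin (3 * p)))
       + \<zeta> t * (4 * e * sin (4 * p)),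
     (sin t)\<^sup>2 * (L * e * (7 / 3 * sin (4 * p) * sin (3 * p)))
       + \<zeta> t * (- 4 * s * e / L * sin (4 * p))]"

lemma bent_has_derivative:
  "(bent e L s has_derivative
     (\<lambda>v. v $ 1 *\<^sub>R bent_t e L s (x $ 1) (x $ 2) + v $ 2 *\<^sub>R bent_p e L s (x $ 1) (x $ 2))) (at x)"
proof -
  have sq: "((\<lambda>t. (sin t)\<^sup>2) has_real_derivative 2 * sin t * cos t) (at t)" for t :: real
    by (auto intro!: derivative_eq_intros)
  have c: "((\<lambda>p. c * cos (k * p)) has_real_derivative - c * k * sin (k * p)) (at p)"
    "((\<lambda>p. sin (k * p)) has_real_derivative k * cos (k * p)) (at p)"
    "((\<lambda>p. cos (k * p)) has_real_derivative - k * sin (k * p)) (at p)" for c k p :: real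
    by (auto intro!: derivative_eq_intros)
  show ?thesis
    unfolding bent_def [abs_def]
    by (rule has_derivative_eq_rhs,
        (rule has_derivative_vector3 has_derivative_add has_derivative_separated r_deriv z_deriv
          \<zeta>_deriv sq c DERIV_cmult bend_x_deriv bend_y_deriv DERIV_const)+)
      (simp add: fun_eq_iff vec_eq_iff forall_3 bent_t_def bent_p_def algebra_simps)
qed

text \<open>
  The difference of the two sides is linear in \<open>B\<close>. The products of the derivatives of \<open>e\<^sub>1 \<times> k\<close> with
  those of \<open>k\<close> cancel by antisymmetry, and what remains vanishes by the equations \<open>bending\<close>, one of
  which belongs to the first and the other to the second of the three coefficients of the metric.
\<close>

lemma bent_isometric:
  assumes "L \<noteq> 0"
  shows "bent_t e L 1 t p \<bullet> bent_t e L 1 t p = bent_t e L (- 1) t p \<bullet> bent_t e L (- 1) t p"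
    "bent_t e L 1 t p \<bullet> bent_p e L 1 t p = bent_t e L (- 1) t p \<bullet> bent_p e L (- 1) t p"
    "bent_p e L 1 t p \<bullet> bent_p e L 1 t p = bent_p e L (- 1) t p \<bullet> bent_p e L (- 1) t p"
proof -
  define d where "d = e / L"
  have d: "s * e / L = s * d" "L * d = e" for s using assms by (simp_all add: d_def)
  have inner3: "(vector [a, b, c] :: real ^ 3) \<bullet> vector [a', b', c'] = a * a' + b * b' + c * c'"
    for a b c a' b' c' :: real
    by (simp add: inner_vec_def sum_3)
  note unf = bent_t_def bent_p_def inner3 d(1)
  note comps = bend_components[of p]
  show "bent_t e L 1 t p \<bullet> bent_t e L 1 t p = bent_t e L (- 1) t p \<bullet> bent_t e L (- 1) t p"
    unfolding unf using comps(1) bending(1)[of t] d(2) by algebra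
  \<comment> \<open>The factors \<open>1\<close> and \<open>- 1\<close> below are the two values of \<open>s\<close>; they mark the terms that come from \<open>B\<close>.\<close>
  have mixed: "(\<rho>' * C + 2 * sn * cs * (1 * e * hx)) * (\<rho> * (- 3 * S) + sn\<^sup>2 * (1 * e * (7 / 3 * s4 * C)))
      + (\<rho>' * S + 2 * sn * cs * (1 * e * hy) + b * (- e * c4))
        * (\<rho> * (3 * C) + sn\<^sup>2 * (1 * e * (7 / 3 * s4 * S)) + \<eta> * (4 * e * s4))
      + (a * L + 2 * sn * cs * (L * e * hy) + b * (1 * d * c4))
        * (sn\<^sup>2 * (L * e * (7 / 3 * s4 * S)) + \<eta> * (- 4 * 1 * d * s4))
      = (\<rho>' * C + 2 * sn * cs * (- 1 * e * hx)) * (\<rho> * (- 3 * S) + sn\<^sup>2 * (- 1 * e * (7 / 3 * s4 * C)))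
      + (\<rho>' * S + 2 * sn * cs * (- 1 * e * hy) + b * (- e * c4))
        * (\<rho> * (3 * C) + sn\<^sup>2 * (- 1 * e * (7 / 3 * s4 * S)) + \<eta> * (4 * e * s4))
      + (a * L + 2 * sn * cs * (L * e * hy) + b * (- 1 * d * c4))
        * (sn\<^sup>2 * (L * e * (7 / 3 * s4 * S)) + \<eta> * (- 4 * - 1 * d * s4))"
    (is "?l = ?r")
    if rel: "C * hy - S * hx = s4" "4 * (a * \<eta>) = 6 * (\<rho> * sn * cs) + 7 / 3 * (\<rho>' * sn\<^sup>2)"
      "S\<^sup>2 + C\<^sup>2 = 1"
    for C S sn cs s4 c4 hx hy \<rho> \<rho>' a b \<eta> :: real
  proof -
    have "?l - ?r = 2 * e * (7 / 3 * \<rho>' * sn\<^sup>2 * s4 * (S\<^sup>2 + C\<^sup>2 - 1)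
        + 6 * sn * cs * \<rho> * (C * hy - S * hx - s4)
        - s4 * (4 * (a * \<eta>) - (6 * (\<rho> * sn * cs) + 7 / 3 * (\<rho>' * sn\<^sup>2))))
      + (L * d - e) * (2 * (- 4 * a * \<eta> * s4 - 8 * sn * cs * e * hy * \<eta> * s4
        + 7 / 3 * b * c4 * e * sn\<^sup>2 * s4 * S))"
      by (simp add: field_simps power2_eq_square)
    also have "\<dots> = 0" unfolding rel d(2) by simp
    finally show ?thesis by simp
  qed
  have angular: "(\<rho> * (- 3 * S) + sn\<^sup>2 * (1 * e * (7 / 3 * s4 * C)))
        * (\<rho> * (- 3 * S) + sn\<^sup>2 * (1 * e * (7 / 3 * s4 * C)))
      + (\<rho> * (3 * C) + sn\<^sup>2 * (1 * e * (7 / 3 * s4 * S)) + \<eta> * (4 * e * s4))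
        * (\<rho> * (3 * C) + sn\<^sup>2 * (1 * e * (7 / 3 * s4 * S)) + \<eta> * (4 * e * s4))
      + (sn\<^sup>2 * (L * e * (7 / 3 * s4 * S)) + \<eta> * (- 4 * 1 * d * s4))
        * (sn\<^sup>2 * (L * e * (7 / 3 * s4 * S)) + \<eta> * (- 4 * 1 * d * s4))
      = (\<rho> * (- 3 * S) + sn\<^sup>2 * (- 1 * e * (7 / 3 * s4 * C)))
        * (\<rho> * (- 3 * S) + sn\<^sup>2 * (- 1 * e * (7 / 3 * s4 * C)))
      + (\<rho> * (3 * C) + sn\<^sup>2 * (- 1 * e * (7 / 3 * s4 * S)) + \<eta> * (4 * e * s4))
        * (\<rho> * (3 * C) + sn\<^sup>2 * (- 1 * e * (7 / 3 * s4 * S)) + \<eta> * (4 * e * s4))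
      + (sn\<^sup>2 * (L * e * (7 / 3 * s4 * S)) + \<eta> * (- 4 * - 1 * d * s4))
        * (sn\<^sup>2 * (L * e * (7 / 3 * s4 * S)) + \<eta> * (- 4 * - 1 * d * s4))"
    (is "?l = ?r")
    for C S sn s4 \<rho> \<eta> :: real
  proof -
    have "?l - ?r = (L * d - e) * (- (112 / 3) * e * \<eta> * s4\<^sup>2 * sn\<^sup>2 * S)"
      by (simp add: field_simps power2_eq_square)
    also have "\<dots> = 0" unfolding d(2) by simp
    finally show ?thesis by simp
  qed
  show "bent_t e L 1 t p \<bullet> bent_p e L 1 t p = bent_t e L (- 1) t p \<bullet> bent_p e L (- 1) t p"
    unfolding unf by (rule mixed[OF comps(2) bending(2) sin_cos_squared_add])
  show "bent_p e L 1 t p \<bullet> bent_p e L 1 t p = bent_p e L (- 1) t p \<bullet> bent_p e L (- 1) t p"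
    unfolding unf by (rule angular)
qed

end

lemma power_series_at_trig:
  "power_series_at (\<lambda>t. (sin t)\<^sup>2) u"
  "power_series_at (\<lambda>p. c * cos (k * p)) u" "power_series_at (\<lambda>p. c * sin (k * p)) u"
  "power_series_at (\<lambda>p. c * bend_x p) u" "power_series_at (\<lambda>p. c * bend_y p) u"
proof -
  show "power_series_at (\<lambda>t. (sin t)\<^sup>2) u"
    by (rule power_series_at_entire[of "\<lambda>w. (sin w)\<^sup>2"]) (auto intro!: holomorphic_intros simp: sin_of_real)
  show "power_series_at (\<lambda>p. c * cos (k * p)) u"
    by (rule power_series_at_entire[of "\<lambda>w. of_real c * cos (of_real k * w)"])
      (auto intro!: holomorphic_intros simp: cos_of_real simp flip: of_real_mult)
  show "power_series_at (\<lambda>p. c * sin (k * p)) u"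
    by (rule power_series_at_entire[of "\<lambda>w. of_real c * sin (of_real k * w)"])
      (auto intro!: holomorphic_intros simp: sin_of_real simp flip: of_real_mult)
  have eq: "cos (4 * of_real y) = (of_real (cos (4 * y)) :: complex)"
    "cos (3 * of_real y) = (of_real (cos (3 * y)) :: complex)"
    "sin (4 * of_real y) = (of_real (sin (4 * y)) :: complex)"
    "sin (3 * of_real y) = (of_real (sin (3 * y)) :: complex)" for y
    using cos_of_real[of "4 * y"] cos_of_real[of "3 * y"] sin_of_real[of "4 * y"] sin_of_real[of "3 * y"]
    by simp_all
  show "power_series_at (\<lambda>p. c * bend_x p) u"
    by (rule power_series_at_entire[of "\<lambda>w. of_real c *
        (- (4 / 3) * cos (4 * w) * cos (3 * w) - sin (4 * w) * sin (3 * w))"])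
      (auto intro!: holomorphic_intros simp: eq bend_x_def)
  show "power_series_at (\<lambda>p. c * bend_y p) u"
    by (rule power_series_at_entire[of "\<lambda>w. of_real c *
        (- (4 / 3) * cos (4 * w) * sin (3 * w) + sin (4 * w) * cos (3 * w))"])
      (auto intro!: holomorphic_intros simp: eq bend_y_def)
qed


section \<open>The bent surfaces are analytic immersions\<close>

context flexible_profile
begin

text \<open>
  The central symmetry that reduces the comparison of diameters to a comparison of norms.
\<close>

lemma bent_antipodal: "bent e L s (x + vector [pi, pi]) = - bent e L s x"
  by (simp add: bent_def vec_eq_iff forall_3 shift sin_cos_multiple_shift bend_shift
      del: distrib_left_numeral)

lemma doubly_periodic_bent: "doubly_periodic (bent e L s)"
  unfolding doubly_periodic_def
proof (intro allI impI)
  fix x y assume "torus_cover x = torus_cover y"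
  then have cis: "cis (x $ 1) = cis (y $ 1)" "cis (x $ 2) = cis (y $ 2)"
    by (simp_all add: torus_cover_def)
  have twice: "t + 2 * pi = (t + pi) + pi" for t :: real by simp
  note unf = shift sin_cos_multiple_shift bend_shift minus_minus
  have "f (x $ 1) = f (y $ 1)" if "f = r \<or> f = z \<or> f = \<zeta> \<or> f = sin" for f
    by (rule cis_eq_imp_periodic_eq[OF _ cis(1)]) (use that in \<open>auto simp only: twice unf sin_periodic_pi\<close>)
  moreover have "f (x $ 2) = f (y $ 2)"
    if "f = bend_x \<or> f = bend_y \<or> f = (\<lambda>p. cos (3 * p)) \<or> f = (\<lambda>p. sin (3 * p)) \<or> f = (\<lambda>p. cos (4 * p))"
    for f
    by (rule cis_eq_imp_periodic_eq[OF _ cis(2)]) (use that in \<open>auto simp only: twice unf\<close>)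
  ultimately show "bent e L s x = bent e L s y"
    unfolding bent_def by metis
qed

lemma real_analytic_bent: "real_analytic_at (bent e L s) x"
proof (rule real_analytic_at_componentwise)
  fix i :: 3
  note ps = analytic power_series_at_trig power_series_at_trig(2,3)[where c = 1, unfolded mult_1]
  have const: "power_series_at (\<lambda>_. c) u" for c u
    by (rule power_series_at_entire[of "\<lambda>_. of_real c"]) auto
  have "i = 1 \<or> i = 2 \<or> i = 3" using exhaust_3 by blast
  then show "real_analytic_at (\<lambda>y. bent e L s y $ i) x"
    unfolding bent_def
    by (elim disjE; simp only: vector_3;
      intro real_analytic_at_add real_analytic_at_separated ps const)
qed

text \<open>
  After dividing the third component by \<open>L\<close>, the derivative of the surface is that of the unbent
  surface of revolution plus \<open>e\<close> times a matrix that is bounded for \<open>L \<ge> 1\<close>. The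
  derivative of the unbent surface stretches every vector by at least a fixed factor, so it absorbs
  the perturbation when \<open>e\<close> is small. Independence of \<open>L\<close> matters, since \<open>L\<close> is chosen after \<open>e\<close>.
\<close>

lemma immersion_for_small_bending:
  obtains e0 where "e0 > 0"
    "\<And>e L s t p (v :: real ^ 2). \<lbrakk>0 < e; e < e0; L \<ge> 1; s = 1 \<or> s = - 1;
      v $ 1 *\<^sub>R bent_t e L s t p + v $ 2 *\<^sub>R bent_p e L s t p = 0\<rbrakk> \<Longrightarrow> v = 0"
proof -
  have twice: "t + 2 * pi = (t + pi) + pi" for t :: real by simp
  have shift': "r' (t + pi) = r' t" "z' (t + pi) = - z' t" "\<zeta>' (t + pi) = - \<zeta>' t" for t
    using shifted_derivative[of r pi 1 r'] shifted_derivative[of z pi "- 1" z']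
      shifted_derivative[of \<zeta> pi "- 1" \<zeta>'] shift r_deriv z_deriv \<zeta>_deriv by simp_all
  have cont: "continuous_on UNIV r" "continuous_on UNIV \<zeta>"
    using r_deriv \<zeta>_deriv by (meson DERIV_continuous_on has_field_derivative_at_within)+
  obtain K1 where K1: "K1 > 0" "\<And>t. \<bar>\<zeta> t\<bar> \<le> K1"
    using periodic_bounded[OF cont(2)] unfolding twice shift by auto
  obtain K2 where K2: "K2 > 0" "\<And>t. \<bar>\<zeta>' t\<bar> \<le> K2"
    using periodic_bounded[OF cont'(3)] unfolding twice shift' by auto
  define K where "K = max K1 K2"
  have K: "K > 0" "\<bar>\<zeta> t\<bar> \<le> K" "\<bar>\<zeta>' t\<bar> \<le> K" for t
    using K1(1) K2(2)[of t] K1(2)[of t] by (auto simp: K_def)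
  have cont_sq: "continuous_on UNIV (\<lambda>t. (r' t)\<^sup>2 + (z' t)\<^sup>2)"
      "continuous_on UNIV (\<lambda>t. 9 * (r t)\<^sup>2)"
    by (intro continuous_intros cont cont')+
  have "(r' t)\<^sup>2 + (z' t)\<^sup>2 > 0" for t
    using regular[of t] by (simp add: sum_power2_gt_zero_iff)
  then obtain m1 where m1: "m1 > 0" "\<And>t. (r' t)\<^sup>2 + (z' t)\<^sup>2 \<ge> m1"
    using periodic_bounded_below[OF cont_sq(1)] unfolding twice shift' power2_minus by auto
  have "9 * (r t)\<^sup>2 > 0" for t using r_pos[of t] by simp
  then obtain m2 where m2: "m2 > 0" "\<And>t. 9 * (r t)\<^sup>2 \<ge> m2"
    using periodic_bounded_below[OF cont_sq(2)] unfolding twice shift by auto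
  define m where "m = min m1 m2"
  have m: "m > 0" "(r' t)\<^sup>2 + (z' t)\<^sup>2 \<ge> m" "9 * (r t)\<^sup>2 \<ge> m" for t
    using m1(1) m2(1) m1(2)[of t] m2(2)[of t] by (auto simp: m_def)
  define B where "B = 5 * K + 5"
  have B: "B > 0" using K by (simp add: B_def)
  show ?thesis
  proof
    show "sqrt (m / (6 * B\<^sup>2)) > 0" using m B by simp
    fix e L s t p :: real and v :: "real ^ 2"
    assume e: "0 < e" "e < sqrt (m / (6 * B\<^sup>2))" and L: "L \<ge> 1" and s: "s = 1 \<or> s = - 1"
      and zero: "v $ 1 *\<^sub>R bent_t e L s t p + v $ 2 *\<^sub>R bent_p e L s t p = 0"
    define a b where "a = v $ 1" and "b = v $ 2"
    define C S c4 s4 where "C = cos (3 * p)" and "S = sin (3 * p)"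
      and "c4 = cos (4 * p)" and "s4 = sin (4 * p)"
    \<comment> \<open>\<open>X1\<close>, \<open>X2\<close>, \<open>Y\<close> are the components of the derivative of the unstretched bending in direction \<open>v\<close>.\<close>
    define X1 X2 where "X1 = a * (2 * sin t * cos t) * bend_x p + b * (sin t)\<^sup>2 * (7 / 3 * s4 * C)"
      and "X2 = a * (2 * sin t * cos t) * bend_y p + b * (sin t)\<^sup>2 * (7 / 3 * s4 * S)"
    define Y where "Y = a * (\<zeta>' t * c4) - 4 * b * (\<zeta> t * s4)"
    have e1: "a * r' t * C - 3 * b * r t * S = - e * (s * X1)"
      using arg_cong[OF zero, of "\<lambda>u. u $ 1"]
      by (simp add: bent_t_def bent_p_def a_def b_def C_def S_def X1_def s4_def algebra_simps)
    have e2: "a * r' t * S + 3 * b * r t * C = - e * (s * X2 - Y)"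
      using arg_cong[OF zero, of "\<lambda>u. u $ 2"]
      by (simp add: bent_t_def bent_p_def a_def b_def C_def S_def X2_def Y_def s4_def c4_def algebra_simps)
    have "L * (a * z' t) = L * (- e * (X2 + s * Y / L\<^sup>2))"
      using arg_cong[OF zero, of "\<lambda>u. u $ 3"] L
      by (simp add: bent_t_def bent_p_def a_def b_def C_def S_def X2_def Y_def s4_def c4_def
          field_simps power2_eq_square)
    then have e3: "a * z' t = - e * (X2 + s * Y / L\<^sup>2)"
      using L mult_left_cancel[of L "a * z' t" "- e * (X2 + s * Y / L\<^sup>2)"] by linarith
    define N where "N = \<bar>a\<bar> + \<bar>b\<bar>"
    have prod: "\<bar>c * u * w\<bar> \<le> \<bar>c\<bar> * k * l" if "\<bar>u\<bar> \<le> k" "\<bar>w\<bar> \<le> l" for c u w k l :: real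
      using that by (auto simp: abs_mult intro!: mult_mono)
    have sc: "\<bar>2 * sin t * cos t\<bar> \<le> 2" "\<bar>(sin t)\<^sup>2\<bar> \<le> 1"
      by (intro abs_cos_mult_le abs_sin_mult_le; simp) (simp add: abs_square_le_1)
    have X: "\<bar>X1\<bar> \<le> 14 / 3 * N" "\<bar>X2\<bar> \<le> 14 / 3 * N"
      unfolding X1_def X2_def N_def C_def S_def s4_def
      by (rule order_trans[OF abs_triangle_ineq order_trans[OF add_mono[OF
            prod[OF sc(1) bend_bounds(1)] prod[OF sc(2) bend_bounds(3)]]]], simp,
          rule order_trans[OF abs_triangle_ineq order_trans[OF add_mono[OF
            prod[OF sc(1) bend_bounds(2)] prod[OF sc(2) bend_bounds(4)]]]], simp)
    have Y: "\<bar>Y\<bar> \<le> 4 * K * N"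
    proof -
      have "\<bar>a * (\<zeta>' t * c4)\<bar> \<le> \<bar>a\<bar> * K" "\<bar>4 * b * (\<zeta> t * s4)\<bar> \<le> 4 * \<bar>b\<bar> * K"
        unfolding abs_mult c4_def s4_def
        using abs_cos_mult_le[OF K(3)[of t], of "4 * p"] abs_sin_mult_le[OF K(2)[of t], of "4 * p"]
        by (auto simp: abs_mult intro!: mult_mono)
      moreover have "\<bar>a\<bar> * K + 4 * \<bar>b\<bar> * K \<le> 4 * K * N"
        using K(1) by (simp add: N_def algebra_simps)
      ultimately show ?thesis unfolding Y_def by linarith
    qed
    have YL: "\<bar>s * Y / L\<^sup>2\<bar> \<le> 4 * K * N"
    proof -
      have "L\<^sup>2 \<ge> 1" using L by simp
      then have "\<bar>Y\<bar> / L\<^sup>2 \<le> \<bar>Y\<bar> / 1" by (intro divide_left_mono) auto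
      moreover have "\<bar>s * Y / L\<^sup>2\<bar> = \<bar>Y\<bar> / L\<^sup>2" using s by (auto simp: abs_divide)
      ultimately show ?thesis using Y by linarith
    qed
    have sX: "\<bar>s * X1\<bar> = \<bar>X1\<bar>" "\<bar>s * X2\<bar> = \<bar>X2\<bar>" using s by auto
    have N: "N \<ge> 0" by (simp add: N_def)
    have BN: "14 / 3 * N + 4 * K * N \<le> B * N" "14 / 3 * N \<le> B * N"
      using N K(1) mult_nonneg_nonneg[of K N] by (simp_all add: B_def algebra_simps)
    have bounds: "\<bar>s * X1\<bar> \<le> B * N" "\<bar>s * X2 - Y\<bar> \<le> B * N" "\<bar>X2 + s * Y / L\<^sup>2\<bar> \<le> B * N"
    proof -
      show "\<bar>s * X1\<bar> \<le> B * N" using X(1) BN(2) sX(1) by simp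
      show "\<bar>s * X2 - Y\<bar> \<le> B * N"
        by (rule order_trans[OF abs_triangle_ineq4 order_trans[OF add_mono[OF _ Y] BN(1)]])
          (use X(2) sX(2) in simp)
      show "\<bar>X2 + s * Y / L\<^sup>2\<bar> \<le> B * N"
        by (rule order_trans[OF abs_triangle_ineq order_trans[OF add_mono[OF X(2) YL] BN(1)]])
    qed
    have sq: "u\<^sup>2 \<le> (B * N)\<^sup>2" if "\<bar>u\<bar> \<le> B * N" for u
      using power_mono[OF that abs_ge_zero, of 2] by simp
    have CS: "C\<^sup>2 + S\<^sup>2 = 1" by (simp add: C_def S_def)
    have "m * (a\<^sup>2 + b\<^sup>2) \<le> ((r' t)\<^sup>2 + (z' t)\<^sup>2) * a\<^sup>2 + 9 * (r t)\<^sup>2 * b\<^sup>2"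
      using mult_right_mono[OF m(2)[of t] zero_le_power2[of a]]
        mult_right_mono[OF m(3)[of t] zero_le_power2[of b]]
      by (simp add: algebra_simps)
    also have "\<dots> = (a * r' t * C - 3 * b * r t * S)\<^sup>2 + (a * r' t * S + 3 * b * r t * C)\<^sup>2 + (a * z' t)\<^sup>2"
      using CS by algebra
    also have "\<dots> = e\<^sup>2 * ((s * X1)\<^sup>2 + (s * X2 - Y)\<^sup>2 + (X2 + s * Y / L\<^sup>2)\<^sup>2)"
      unfolding e1 e2 e3 power_mult_distrib[of "- e"] power2_minus by (simp only: distrib_left)
    also have "\<dots> \<le> e\<^sup>2 * (3 * (B * N)\<^sup>2)"
      using sq[OF bounds(1)] sq[OF bounds(2)] sq[OF bounds(3)] by (intro mult_left_mono) auto
    also have "\<dots> = 3 * e\<^sup>2 * B\<^sup>2 * N\<^sup>2" by (simp add: power_mult_distrib)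
    also have "\<dots> \<le> 3 * e\<^sup>2 * B\<^sup>2 * (2 * (a\<^sup>2 + b\<^sup>2))"
    proof (rule mult_left_mono)
      have "0 \<le> (\<bar>a\<bar> - \<bar>b\<bar>)\<^sup>2" by simp
      then show "N\<^sup>2 \<le> 2 * (a\<^sup>2 + b\<^sup>2)" by (simp add: N_def power2_eq_square algebra_simps)
    qed simp
    finally have le: "m * (a\<^sup>2 + b\<^sup>2) \<le> 6 * B\<^sup>2 * e\<^sup>2 * (a\<^sup>2 + b\<^sup>2)" by (simp add: algebra_simps)
    have "e\<^sup>2 < (sqrt (m / (6 * B\<^sup>2)))\<^sup>2" using e by (intro power_strict_mono) auto
    then have "6 * B\<^sup>2 * e\<^sup>2 < m" using m B by (simp add: field_simps)
    then have "a\<^sup>2 + b\<^sup>2 \<le> 0" using le mult_strict_right_mono[of "6 * B\<^sup>2 * e\<^sup>2" m "a\<^sup>2 + b\<^sup>2"]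
      by (meson not_le)
    then have "a = 0" "b = 0" by (simp_all add: sum_power2_le_zero_iff)
    then show "v = 0" by (simp add: a_def b_def vec_eq_iff forall_2)
  qed
qed

end

section \<open>The bent surfaces are not congruent\<close>

text \<open>
  The reason why the sign of \<open>B\<close> matters: the functions \<open>cos 4p\<close> and \<open>sin 3p\<close> can be \<open>1\<close> and \<open>\<plusminus> 1\<close>
  at the same time, as at \<open>p = \<pi> / 2\<close>, but never \<open>- 1\<close> and \<open>\<plusminus> 1\<close>.
\<close>

lemma cos4_sin3_not_extremal:
  fixes p \<sigma> :: real
  assumes "\<sigma> = 1 \<or> \<sigma> = - 1" "cos (4 * p) = - 1"
  shows "sin (3 * p) \<noteq> \<sigma>"
proof
  assume s: "sin (3 * p) = \<sigma>"
  have "(sin (3 * p))\<^sup>2 = 1" using assms(1) s by auto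
  then have c3: "cos (3 * p) = 0" using sin_cos_squared_add[of "3 * p"] by simp
  have "cos (4 * p) = cos (3 * p + p)" by (rule arg_cong) simp
  also have "\<dots> = - \<sigma> * sin p" unfolding cos_add c3 s by simp
  finally have "(sin p)\<^sup>2 = 1" using assms by auto
  then have "cos p = 0" using sin_cos_squared_add[of p] by simp
  then have "cos (2 * p) = - 1" by (simp add: cos_double_cos)
  then have "cos (2 * (2 * p)) = 1" by (subst cos_double_cos) simp
  then show False using assms(2) by simp
qed

text \<open>
  On the tip circles the squared norms of \<open>A + B\<close> and \<open>A - B\<close> depend on \<open>p\<close> through this
  expression and its counterpart with \<open>- q\<close> for \<open>q\<close>, respectively, and through multiples of
  \<open>cos\<^sup>2 4p\<close> that are the same for both. The bound \<open>a + q\<close> is attained by the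
  counterpart, at \<open>p = \<pi> / 2\<close> or at \<open>p = - \<pi> / 2\<close> depending on \<open>\<sigma>\<close>, but not by the expression itself.
\<close>

lemma tip_inequality:
  fixes a q p \<sigma> :: real
  assumes "a > 0" "q > 0" "\<sigma> = 1 \<or> \<sigma> = - 1"
  shows "- cos (4 * p) * (\<sigma> * a * sin (3 * p) + q) < a + q"
proof -
  define c S where "c = cos (4 * p)" and "S = \<sigma> * sin (3 * p)"
  have c: "- 1 \<le> c" "c \<le> 1" by (simp_all add: c_def)
  have S: "- 1 \<le> S" "S \<le> 1" using assms(3) by (auto simp: S_def)
  have aS: "a * S \<le> a" "- a \<le> a * S" using mult_left_mono[OF S(2), of a] mult_left_mono[OF S(1), of a] assms by auto
  have "- c * (a * S + q) < a + q"
  proof (cases "c \<ge> 0")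
    case True
    have "- (c * (a * S)) \<le> c * a" using mult_left_mono[OF aS(2) True] by simp
    also have "\<dots> \<le> a" using mult_right_mono[OF c(2), of a] assms by simp
    finally have "- (c * (a * S)) \<le> a" .
    moreover have "0 \<le> c * q" using True assms by simp
    ultimately have "- c * (a * S + q) \<le> a" by (simp add: distrib_left)
    then show ?thesis using assms by simp
  next
    case False
    show ?thesis
    proof (cases "c = - 1")
      case True
      then have "S \<noteq> 1" using cos4_sin3_not_extremal[OF assms(3), of p] assms(3) by (auto simp: c_def S_def)
      then have "a * S < a" using S assms by simp
      then show ?thesis using True by simp
    next
      case False
      have "- c * (a * S + q) \<le> - c * (a + q)" using aS \<open>\<not> c \<ge> 0\<close> by (intro mult_left_mono) auto
      also have "\<dots> < 1 * (a + q)" using False c assms by (intro mult_strict_right_mono) auto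
      finally show ?thesis by simp
    qed
  qed
  then show ?thesis by (simp add: c_def S_def ac_simps)
qed

lemma norm_vector3_squared: "(norm (vector [a, b, c] :: real ^ 3))\<^sup>2 = a\<^sup>2 + b\<^sup>2 + c\<^sup>2" for a b c :: real
  unfolding power2_norm_eq_inner by (simp add: inner_vec_def sum_3 power2_eq_square)

context flexible_profile
begin

text \<open>
  Up to the central symmetry there is only one tip.
\<close>

lemma profile_at_tips:
  assumes "sin t = 0"
  obtains \<sigma> where "\<sigma> = 1 \<or> \<sigma> = - 1" "r t = r 0" "z t = \<sigma> * z 0" "\<zeta> t = \<sigma> * \<zeta> 0"
proof -
  have twice: "t + 2 * pi = (t + pi) + pi" for t :: real by simp
  have per: "f (t + 2 * pi * of_int n) = f t" if "f = r \<or> f = z \<or> f = \<zeta>" for f t n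
    by (rule periodic_int_multiple) (use that in \<open>auto simp only: twice shift minus_minus\<close>)
  obtain i :: int where i: "t = of_int i * pi" using assms sin_zero_iff_int2 by blast
  show ?thesis
  proof (cases "even i")
    case True
    then obtain j where "i = 2 * j" by blast
    then have t: "t = 0 + 2 * pi * of_int j" using i by simp
    show ?thesis by (rule that[of 1]) (simp_all only: t per mult_1 simp_thms)
  next
    case False
    then obtain j where "i = 2 * j + 1" by (rule oddE)
    then have t: "t = 0 + pi + 2 * pi * of_int j" using i by (simp add: algebra_simps)
    show ?thesis by (rule that[of "- 1"]) (simp_all only: t per shift mult_minus_left mult_1 simp_thms)
  qed
qed

text \<open>
  The squared norm of \<open>A + B\<close> is \<open>P + L\<^sup>2 w\<^sup>2 + R / L\<^sup>2\<close>, where \<open>w\<close> is close to the height \<open>z\<close> and,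
  like it, has its maximal modulus exactly on the tip circles. There \<open>P\<close> stays below
  \<open>K\<close> by \<open>tip_inequality\<close>, whereas for \<open>A - B\<close> the corresponding value reaches \<open>K\<close> at \<open>(0, \<pi> / 2)\<close>. For
  large \<open>L\<close> only the tip circles count, by \<open>stretched_below_threshold\<close>.
\<close>

lemma bent_tip_far:
  assumes e: "0 < e" "7 / 3 * e < \<kappa>"
  shows "\<exists>L\<ge>1. \<forall>x. norm (bent e L 1 x) < norm (bent e L (- 1) (vector [0, pi / 2]))"
proof -
  define X where "X = {- pi..pi} \<times> {- pi..pi}"
  define w where "w u = z (fst u) + (sin (fst u))\<^sup>2 * (e * bend_y (snd u))" for u
  define g where "g u = (z 0)\<^sup>2 - (w u)\<^sup>2" for u
  define P where "P u =
      (r (fst u) * cos (3 * snd u) + (sin (fst u))\<^sup>2 * (e * bend_x (snd u)))\<^sup>2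
      + (r (fst u) * sin (3 * snd u) + (sin (fst u))\<^sup>2 * (e * bend_y (snd u))
          + \<zeta> (fst u) * (- e * cos (4 * snd u)))\<^sup>2
      + 2 * e * (w u * (\<zeta> (fst u) * cos (4 * snd u)))" for u
  define R where "R u = e\<^sup>2 * (\<zeta> (fst u))\<^sup>2 * (cos (4 * snd u))\<^sup>2" for u
  define K where "K = (r 0 + e * \<zeta> 0)\<^sup>2 + 2 * e * (\<zeta> 0 * - z 0)"
  have cont: "continuous_on UNIV r" "continuous_on UNIV z" "continuous_on UNIV \<zeta>"
    using r_deriv z_deriv \<zeta>_deriv by (meson DERIV_continuous_on has_field_derivative_at_within)+
  have cont_fst: "continuous_on X (\<lambda>u. f (fst u))" if "continuous_on UNIV f" for f :: "real \<Rightarrow> real"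
    by (rule continuous_on_compose2[OF that]) (auto intro!: continuous_intros)
  note cs = continuous_intros cont_fst[OF cont(1)] cont_fst[OF cont(2)] cont_fst[OF cont(3)]
  have w_bound: "\<bar>w u\<bar> \<le> - z 0 - (\<kappa> - 7 / 3 * e) * (sin (fst u))\<^sup>2" for u
  proof -
    have "\<bar>(sin (fst u))\<^sup>2 * (e * bend_y (snd u))\<bar> = (sin (fst u))\<^sup>2 * (e * \<bar>bend_y (snd u)\<bar>)"
      using e by (simp add: abs_mult)
    also have "\<dots> \<le> (sin (fst u))\<^sup>2 * (e * (7 / 3))"
      using e by (intro mult_left_mono bend_bounds(2)) auto
    finally have "\<bar>w u\<bar> \<le> \<bar>z (fst u)\<bar> + (sin (fst u))\<^sup>2 * (e * (7 / 3))"
      unfolding w_def by linarith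
    then show ?thesis using top(2)[of "fst u"] by (simp add: algebra_simps)
  qed
  have slack: "(\<kappa> - 7 / 3 * e) * (sin t)\<^sup>2 \<ge> 0" for t using e by simp
  have "\<exists>L\<ge>1. \<forall>u\<in>X. P u - L\<^sup>2 * g u + R u / L\<^sup>2 < K"
  proof (rule stretched_below_threshold)
    show "compact X" unfolding X_def by (intro compact_Times) auto
    have "continuous_on X w" unfolding w_def by (intro cs)
    then show "continuous_on X g" "continuous_on X P" "continuous_on X R"
      unfolding g_def P_def R_def by (intro cs; assumption?)+
    fix u
    have "\<bar>w u\<bar> \<le> \<bar>z 0\<bar>" using w_bound[of u] slack[of "fst u"] z0_neg by linarith
    then show "g u \<ge> 0" unfolding g_def by (simp add: abs_le_square_iff)
    show "P u < K" if "g u = 0"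
    proof -
      have "\<bar>w u\<bar> = \<bar>z 0\<bar>" using that by (auto simp: g_def power2_eq_iff abs_eq_iff)
      then have "(\<kappa> - 7 / 3 * e) * (sin (fst u))\<^sup>2 \<le> 0" using w_bound[of u] z0_neg by linarith
      then have s: "sin (fst u) = 0" using e by (simp add: mult_le_0_iff)
      obtain \<sigma> where \<sigma>: "\<sigma> = 1 \<or> \<sigma> = - 1" "r (fst u) = r 0" "z (fst u) = \<sigma> * z 0" "\<zeta> (fst u) = \<sigma> * \<zeta> 0"
        using profile_at_tips[OF s] by blast
      define c S where "c = cos (4 * snd u)" and "S = sin (3 * snd u)"
      have \<sigma>2: "\<sigma> * \<sigma> = 1" using \<sigma>(1) by auto
      have CS: "(cos (3 * snd u))\<^sup>2 = 1 - S\<^sup>2" by (simp add: S_def cos_squared_eq)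
      have "P u = (r 0 * cos (3 * snd u))\<^sup>2 + (r 0 * S - \<sigma> * \<zeta> 0 * e * c)\<^sup>2
          + 2 * e * (\<sigma> * z 0 * (\<sigma> * \<zeta> 0 * c))"
        by (simp add: P_def w_def s \<sigma>(2-4) c_def S_def algebra_simps)
      also have "\<dots> = (r 0)\<^sup>2 + (e * \<zeta> 0)\<^sup>2 * c\<^sup>2 + 2 * e * \<zeta> 0 * (- c * (\<sigma> * r 0 * S + - z 0))"
        unfolding power_mult_distrib[of "r 0"] CS using \<sigma>2 by algebra
      also have "\<dots> < (r 0)\<^sup>2 + (e * \<zeta> 0)\<^sup>2 * 1 + 2 * e * \<zeta> 0 * (r 0 + - z 0)"
      proof -
        have "2 * e * \<zeta> 0 * (- c * (\<sigma> * r 0 * S + - z 0)) < 2 * e * \<zeta> 0 * (r 0 + - z 0)"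
          unfolding c_def S_def
          by (intro mult_strict_left_mono tip_inequality r_pos \<sigma>(1)) (use z0_neg \<zeta>0_pos e in auto)
        moreover have "(e * \<zeta> 0)\<^sup>2 * c\<^sup>2 \<le> (e * \<zeta> 0)\<^sup>2 * 1"
          by (intro mult_left_mono) (auto simp: c_def abs_square_le_1)
        ultimately show ?thesis by linarith
      qed
      also have "\<dots> = K" by (simp add: K_def power2_eq_square algebra_simps)
      finally show ?thesis .
    qed
  qed
  then obtain L where L: "L \<ge> 1" "\<And>u. u \<in> X \<Longrightarrow> P u - L\<^sup>2 * g u + R u / L\<^sup>2 < K" by blast
  have "norm (bent e L 1 x) < norm (bent e L (- 1) (vector [0, pi / 2]))" for x
  proof -
    define y :: "real ^ 2" where "y = vector [Arg (cis (x $ 1)), Arg (cis (x $ 2))]"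
    have "torus_cover y = torus_cover x" by (simp add: y_def torus_cover_def cis_Arg_unit)
    then have yx: "bent e L 1 y = bent e L 1 x"
      using doubly_periodic_bent unfolding doubly_periodic_def by blast
    define u where "u = (y $ 1, y $ 2)"
    have u: "u \<in> X" using Arg_in_interval by (simp add: u_def y_def X_def)
    have split: "(L * \<omega> + \<eta> * (e / L * c))\<^sup>2 = L\<^sup>2 * \<omega>\<^sup>2 + 2 * e * (\<omega> * (\<eta> * c)) + e\<^sup>2 * \<eta>\<^sup>2 * c\<^sup>2 / L\<^sup>2"
      for \<omega> \<eta> c using L(1) by (simp add: field_simps power2_eq_square)
    have "(norm (bent e L 1 y))\<^sup>2 = P u + R u / L\<^sup>2 + L\<^sup>2 * (w u)\<^sup>2"
      using split[of "w u" "\<zeta> (y $ 1)" "cos (4 * y $ 2)"]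
      unfolding bent_def norm_vector3_squared by (simp add: P_def R_def u_def w_def algebra_simps)
    also have "\<dots> = (P u - L\<^sup>2 * g u + R u / L\<^sup>2) + L\<^sup>2 * (z 0)\<^sup>2"
      by (simp add: g_def algebra_simps)
    also have "\<dots> < K + L\<^sup>2 * (z 0)\<^sup>2" using L(2)[OF u] by simp
    also have "\<dots> \<le> (norm (bent e L (- 1) (vector [0, pi / 2])))\<^sup>2"
    proof -
      have "3 * (pi / 2) = pi / 2 + pi" "4 * (pi / 2) = 2 * pi" by simp_all
      then have trig: "sin (3 * (pi / 2)) = - 1" "cos (3 * (pi / 2)) = 0" "cos (4 * (pi / 2)) = 1"
        by (simp_all only: sin_periodic_pi cos_periodic_pi sin_pi_half cos_pi_half cos_two_pi minus_zero)
      have "(norm (bent e L (- 1) (vector [0, pi / 2])))\<^sup>2 = (r 0 + e * \<zeta> 0)\<^sup>2 + (L * z 0 + \<zeta> 0 * (e / L * - 1))\<^sup>2"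
        unfolding bent_def norm_vector3_squared vector_2 trig by (simp add: power2_eq_square algebra_simps)
      also have "\<dots> = K + L\<^sup>2 * (z 0)\<^sup>2 + e\<^sup>2 * (\<zeta> 0)\<^sup>2 / L\<^sup>2"
        unfolding split K_def by simp
      finally show ?thesis by simp
    qed
    finally have "(norm (bent e L 1 x))\<^sup>2 < (norm (bent e L (- 1) (vector [0, pi / 2])))\<^sup>2"
      unfolding yx .
    then show ?thesis by (rule power2_less_imp_less) simp
  qed
  then show ?thesis using L(1) by blast
qed

text \<open>
  The factor \<open>e\<close> has to be small for two reasons: the surfaces have to be immersed, and the bending
  must not move the maximum of the height away from the tips, which requires \<open>7 / 3 * e < \<kappa>\<close>.
\<close>

theorem noncongruent_isometric_tori:
  "\<exists>f g :: complex \<times> complex \<Rightarrow> real ^ 3.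
     real_analytic_immersion torus_atlas f \<and> real_analytic_immersion torus_atlas g \<and>
     same_induced_metric torus_atlas f g \<and>
     \<not> related_by_ambient_isometry torus_space torus_atlas f g"
proof -
  obtain e0 where e0: "e0 > 0"
    "\<And>e L s t p (v :: real ^ 2). \<lbrakk>0 < e; e < e0; L \<ge> 1; s = 1 \<or> s = - 1;
      v $ 1 *\<^sub>R bent_t e L s t p + v $ 2 *\<^sub>R bent_p e L s t p = 0\<rbrakk> \<Longrightarrow> v = 0"
    using immersion_for_small_bending by blast
  define e where "e = min e0 (3 / 7 * \<kappa>) / 2"
  have e: "0 < e" "e < e0" "7 / 3 * e < \<kappa>"
    using e0(1) top(1) by (auto simp: e_def min_def)
  obtain L where L: "L \<ge> 1"
    "\<And>x. norm (bent e L 1 x) < norm (bent e L (- 1) (vector [0, pi / 2]))"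
    using bent_tip_far[OF e(1,3)] by blast
  define D where "D s x v = v $ 1 *\<^sub>R bent_t e L s (x $ 1) (x $ 2) + v $ 2 *\<^sub>R bent_p e L s (x $ 1) (x $ 2)"
    for s and x v :: "real ^ 2"
  have D: "(bent e L s has_derivative D s x) (at x)" for s x
    unfolding D_def using bent_has_derivative by blast
  have immersion: "real_analytic_immersion torus_atlas (from_cover (bent e L s))"
    if s: "s = 1 \<or> s = - 1" for s
  proof (rule real_analytic_immersion_from_cover[OF doubly_periodic_bent real_analytic_bent D])
    fix x
    have "linear (D s x)" using D by (rule has_derivative_linear)
    moreover have "v = 0" if "D s x v = 0" for v
      using e0(2)[OF e(1,2) L(1) s] that unfolding D_def by blast
    ultimately show "inj (D s x)" by (simp add: linear_injective_0)
  qed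
  have "same_induced_metric torus_atlas (from_cover (bent e L 1)) (from_cover (bent e L (- 1)))"
  proof (rule same_induced_metric_from_cover[OF doubly_periodic_bent doubly_periodic_bent D D])
    fix x v w
    show "D 1 x v \<bullet> D 1 x w = D (- 1) x v \<bullet> D (- 1) x w"
      using bent_isometric[of L e "x $ 1" "x $ 2"] L(1)
      by (simp add: D_def inner_add_left inner_add_right inner_commute)
  qed
  moreover have "\<not> related_by_ambient_isometry torus_space torus_atlas
      (from_cover (bent e L 1)) (from_cover (bent e L (- 1)))"
    by (rule not_related_from_cover[OF doubly_periodic_bent doubly_periodic_bent bent_antipodal L(2)])
  ultimately show ?thesis using immersion[of 1] immersion[of "- 1"] by blast
qed

end

section \<open>A closed profile that admits a bending\<close>

text \<open>
  These functions arise as follows. Suppose that \<open>log r\<close> is a trigonometric polynomial of degree one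
  in \<open>2 t\<close>. The equations \<open>bending\<close>, with \<open>\<tau> = sin\<^sup>2 t\<close>, then make the logarithmic derivative of \<open>\<zeta>\<close> a
  rational function of \<open>tan t\<close> with one real and two conjugate complex poles. For \<open>\<zeta>\<close> to be regular and
  to change its sign under \<open>t \<mapsto> t + \<pi>\<close>, the residue at the real pole has to be \<open>1\<close> and the other two
  have to be real. These conditions leave one parameter, here called \<open>shear\<close>, which determines the
  frequency \<open>n\<close> of the bending by \<open>n\<^sup>2 = (3 + shear\<^sup>2) / (1 + shear\<^sup>2)\<close>; the value \<open>shear\<^sup>2 = 11 / 7\<close> belongs
  to \<open>n = 4 / 3\<close>. The quadratic form \<open>quad\<close> in \<open>sin t\<close> and \<open>cos t\<close> carries the complex poles.
\<close>

definition shear :: real where "shear = sqrt (11 / 7)"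

definition quad :: "real \<Rightarrow> real" where
  "quad t = 11 / 7 + 4 * (cos t)\<^sup>2 + 2 * shear * sin t * cos t"

definition radius :: "real \<Rightarrow> real" where
  "radius t = exp (3 / 325 * (11 * shear * sin (2 * t) + 61 * cos (2 * t)))"

definition radius' :: "real \<Rightarrow> real" where
  "radius' t = radius t * (6 / 325 * (11 * shear * cos (2 * t) - 61 * sin (2 * t)))"

definition height' :: "real \<Rightarrow> real" where
  "height' t = sin t * radius t * quad t powr (- 11 / 14)"

definition height :: "real \<Rightarrow> real" where
  "height t = (LBINT u=0..t. height' u) - (LBINT u=0..pi. height' u) / 2"

definition lift :: "real \<Rightarrow> real" where
  "lift t = 7 / 650 * (25 * cos t - 7 * shear * sin t) * quad t powr (25 / 14)"

definition lift' :: "real \<Rightarrow> real" where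
  "lift' t = 7 / 650 * ((- 25 * sin t - 7 * shear * cos t) * quad t
     + 25 / 14 * (25 * cos t - 7 * shear * sin t) * (2 * shear * ((cos t)\<^sup>2 - (sin t)\<^sup>2) - 8 * sin t * cos t))
     * quad t powr (11 / 14)"

lemma shear: "shear\<^sup>2 = 11 / 7" "shear > 0"
  by (simp_all add: shear_def)

lemma quad_pos: "quad t > 0"
proof -
  have "quad t = (2 * cos t + shear * sin t / 2)\<^sup>2 + 11 / 7 * (1 - (sin t)\<^sup>2 / 4)"
    using shear(1) by (simp add: quad_def power2_sum power_mult_distrib power_divide field_simps)
  moreover have "(sin t)\<^sup>2 \<le> 1" by (simp add: abs_square_le_1)
  then have "11 / 7 * (1 - (sin t)\<^sup>2 / 4) > 0" by simp
  ultimately show ?thesis by (simp add: add_nonneg_pos)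
qed

lemma radius_pos: "radius t > 0"
  by (simp add: radius_def)

lemma profile_shift:
  "quad (t + pi) = quad t" "radius (t + pi) = radius t" "height' (t + pi) = - height' t"
  "lift (t + pi) = - lift t"
proof -
  have 2: "2 * (t + pi) = 2 * t + 2 * pi" by simp
  show q: "quad (t + pi) = quad t" by (simp add: quad_def)
  show r: "radius (t + pi) = radius t" unfolding radius_def 2 by simp
  show "height' (t + pi) = - height' t" "lift (t + pi) = - lift t"
    unfolding height'_def lift_def q r sin_periodic_pi cos_periodic_pi by (simp_all add: algebra_simps)
qed

lemma radius_deriv: "(radius has_real_derivative radius' t) (at t)"
  unfolding radius_def [abs_def] radius'_def
  by (auto intro!: derivative_eq_intros simp: field_simps)

lemma quad_deriv:
  "(quad has_real_derivative 2 * shear * ((cos t)\<^sup>2 - (sin t)\<^sup>2) - 8 * sin t * cos t) (at t)"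
  unfolding quad_def [abs_def]
  by (auto intro!: derivative_eq_intros simp: field_simps power2_eq_square)

lemma quad_powr: "quad t powr (25 / 14) = quad t * quad t powr (11 / 14)"
  "quad t powr (- 11 / 14) * quad t powr (11 / 14) = 1"
  using quad_pos[of t] powr_add[of "quad t" 1 "11 / 14"] powr_add[of "quad t" "- 11 / 14" "11 / 14"]
  by simp_all

lemma lift_deriv: "(lift has_real_derivative lift' t) (at t)"
proof -
  have d1: "((\<lambda>t. quad t powr (25 / 14)) has_real_derivative
      25 / 14 * quad t powr (25 / 14 - 1) * (2 * shear * ((cos t)\<^sup>2 - (sin t)\<^sup>2) - 8 * sin t * cos t)) (at t)"
    by (rule DERIV_chain2[OF has_real_derivative_powr[OF quad_pos] quad_deriv])
  have d2: "((\<lambda>t. 7 / 650 * (25 * cos t - 7 * shear * sin t)) has_real_derivative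
      7 / 650 * (- 25 * sin t - 7 * shear * cos t)) (at t)"
    by (auto intro!: derivative_eq_intros)
  show ?thesis
    unfolding lift_def [abs_def] lift'_def
    by (rule DERIV_cong[OF DERIV_mult'[OF d2 d1]]) (simp add: quad_powr field_simps power2_eq_square)
qed

lemma continuous_on_profile [continuous_intros]:
  "continuous_on S quad" "continuous_on S radius"
  by (rule DERIV_continuous_on[OF has_field_derivative_at_within[OF quad_deriv]],
      rule DERIV_continuous_on[OF has_field_derivative_at_within[OF radius_deriv]])

lemma continuous_on_profile' [continuous_intros]:
  "continuous_on S radius'" "continuous_on S height'" "continuous_on S lift'"
  using quad_pos unfolding radius'_def height'_def lift'_def
  by (auto intro!: continuous_intros simp: less_imp_neq[symmetric])

lemma height_deriv: "(height has_real_derivative height' t) (at t)"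
proof -
  define b where "b = \<bar>t\<bar> + 1"
  have "((\<lambda>u. LBINT y=0..u. height' y) has_vector_derivative height' t) (at t within {- b..b})"
    unfolding zero_ereal_def
    by (rule interval_integral_FTC2) (auto simp: b_def intro: continuous_intros)
  then have "((\<lambda>u. LBINT y=0..u. height' y) has_real_derivative height' t) (at t)"
    by (simp add: b_def at_within_Icc_at has_real_derivative_iff_has_vector_derivative)
  then show ?thesis
    unfolding height_def [abs_def] by (auto intro!: derivative_eq_intros)
qed

text \<open>
  The derivative of \<open>height\<close> changes its sign under \<open>t \<mapsto> t + \<pi>\<close>, so a suitable constant of integration
  makes \<open>height\<close> do the same. This closes the profile curve.
\<close>

lemma height_shift: "height (t + pi) = - height t"
proof -
  have "((\<lambda>t. height (t + pi) + height t) has_real_derivative 0) (at t)" for t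
  proof -
    have "((\<lambda>t. height (t + pi)) has_real_derivative - height' t) (at t)"
      using height_deriv[of "t + pi"] by (simp add: DERIV_shift profile_shift(3))
    from DERIV_add[OF this height_deriv] show ?thesis by simp
  qed
  then have "height (t + pi) + height t = height (0 + pi) + height 0"
    by (intro DERIV_isconst_all) blast
  also have "\<dots> = 0" by (simp add: height_def interval_integral_endpoints_same zero_ereal_def[symmetric])
  finally show ?thesis by simp
qed

text \<open>
  On \<open>[0, \<pi>]\<close> the derivative of \<open>height\<close> is \<open>sin t\<close> times a function that is bounded below by some
  \<open>m > 0\<close>. Hence \<open>height t + m * cos t\<close> increases there, and comparison with both end points gives the
  estimate for \<open>|height t|\<close>.
\<close>

lemma height_bounds:
  obtains \<kappa> where "\<kappa> > 0" "height 0 < 0" "\<And>t. \<bar>height t\<bar> \<le> - height 0 - \<kappa> * (sin t)\<^sup>2"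
proof -
  define q where "q t = radius t * quad t powr (- 11 / 14)" for t
  have "q (t + 2 * pi) = q t" for t
  proof -
    have "q (t + 2 * pi) = q ((t + pi) + pi)" by (rule arg_cong) simp
    then show ?thesis by (simp only: q_def profile_shift)
  qed
  moreover have "continuous_on UNIV q"
    unfolding q_def using quad_pos by (auto intro!: continuous_intros simp: less_imp_neq[symmetric])
  moreover have "q t > 0" for t using radius_pos quad_pos[of t] by (simp add: q_def)
  ultimately obtain m where m: "m > 0" "\<And>t. q t \<ge> m"
    by (metis periodic_bounded_below)
  have mono: "height a + m * cos a \<le> height b + m * cos b" if "0 \<le> a" "a \<le> b" "b \<le> pi" for a b
  proof (rule DERIV_nonneg_imp_nondecreasing[OF that(2)])
    fix t assume t: "a \<le> t" "t \<le> b"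
    have "((\<lambda>t. height t + m * cos t) has_real_derivative sin t * (q t - m)) (at t)"
      by (auto intro!: derivative_eq_intros height_deriv simp: height'_def q_def algebra_simps)
    moreover have "sin t * (q t - m) \<ge> 0"
      using m(2)[of t] sin_ge_zero[of t] t that by simp
    ultimately show "\<exists>y. ((\<lambda>t. height t + m * cos t) has_real_derivative y) (at t) \<and> y \<ge> 0" by blast
  qed
  have pi: "height pi = - height 0" using height_shift[of 0] by simp
  have "\<bar>height t\<bar> + m / 2 * (sin t)\<^sup>2 \<le> - height 0" if t: "0 \<le> t" "t \<le> pi" for t
  proof -
    have lower: "height 0 + m * (1 - cos t) \<le> height t" using mono[of 0 t] t by (simp add: algebra_simps)
    have upper: "height t \<le> - height 0 - m * (1 + cos t)" using mono[of t pi] t pi by (simp add: algebra_simps)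
    have "(sin t)\<^sup>2 = (1 - cos t) * (1 + cos t)"
      by (simp add: sin_squared_eq power2_eq_square algebra_simps)
    moreover have "(1 - cos t) * (1 + cos t) \<le> (1 - cos t) * 2" "(1 - cos t) * (1 + cos t) \<le> 2 * (1 + cos t)"
      using mult_left_mono[of "1 + cos t" 2 "1 - cos t"] mult_right_mono[of "1 - cos t" 2 "1 + cos t"]
        cos_ge_minus_one[of t] cos_le_one[of t] by simp_all
    ultimately have "(sin t)\<^sup>2 \<le> 2 * (1 - cos t)" "(sin t)\<^sup>2 \<le> 2 * (1 + cos t)" by linarith+
    then have "m * (sin t)\<^sup>2 \<le> m * (2 * (1 - cos t))" "m * (sin t)\<^sup>2 \<le> m * (2 * (1 + cos t))"
      using m(1) by (auto intro!: mult_left_mono)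
    then show ?thesis using lower upper by (simp add: abs_le_iff algebra_simps)
  qed
  moreover have "\<exists>t0. 0 \<le> t0 \<and> t0 \<le> pi \<and> \<bar>height t\<bar> + m / 2 * (sin t)\<^sup>2 = \<bar>height t0\<bar> + m / 2 * (sin t0)\<^sup>2" for t
  proof -
    define n where "n = \<lfloor>t / pi\<rfloor>"
    define f where "f t = \<bar>height t\<bar> + m / 2 * (sin t)\<^sup>2" for t
    have "f (t - pi * of_int n + pi * of_int n) = f (t - pi * of_int n)"
      by (rule periodic_int_multiple) (simp add: f_def height_shift)
    moreover have "0 \<le> t - pi * of_int n" "t - pi * of_int n \<le> pi"
    proof -
      have "of_int n * pi \<le> t" "t < (of_int n + 1) * pi"
        using floor_divide_lower[OF pi_gt_zero] floor_divide_upper[OF pi_gt_zero] by (simp_all add: n_def)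
      then show "0 \<le> t - pi * of_int n" "t - pi * of_int n \<le> pi" by (simp_all add: algebra_simps)
    qed
    ultimately show ?thesis unfolding f_def by (intro exI[of _ "t - pi * of_int n"]) simp
  qed
  ultimately have bound: "\<bar>height t\<bar> + m / 2 * (sin t)\<^sup>2 \<le> - height 0" for t by metis
  show ?thesis
  proof
    show "m / 2 > 0" using m by simp
    show "height 0 < 0" using mono[of 0 pi] pi m by simp
    show "\<bar>height t\<bar> \<le> - height 0 - m / 2 * (sin t)\<^sup>2" for t using bound[of t] by simp
  qed
qed

text \<open>
  The powers of \<open>quad\<close> in \<open>height'\<close> and in \<open>lift\<close> have been chosen to combine to integer powers. What remains are
  identities between polynomials in \<open>sin t\<close>, \<open>cos t\<close> and \<open>shear\<close>.
\<close>

lemma profile_bending: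
  "height' t * lift' t = 8 / 3 * (radius' t * sin t * cos t)"
  "4 * (height' t * lift t) = 6 * (radius t * sin t * cos t) + 7 / 3 * (radius' t * (sin t)\<^sup>2)"
proof -
  define s c where "s = sin t" and "c = cos t"
  have sc: "s\<^sup>2 + c\<^sup>2 = 1" by (simp add: s_def c_def)
  have double: "cos (2 * t) = c\<^sup>2 - s\<^sup>2" "sin (2 * t) = 2 * s * c"
    by (simp_all add: s_def c_def cos_double sin_double)
  have E: "quad t = 11 / 7 + 4 * c\<^sup>2 + 2 * shear * s * c" by (simp add: quad_def s_def c_def)
  have first: "7 / 650 * ((- 25 * s - 7 * shear * c) * quad t
      + 25 / 14 * (25 * c - 7 * shear * s) * (2 * shear * (c\<^sup>2 - s\<^sup>2) - 8 * s * c))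
      = 8 / 3 * (6 / 325 * (11 * shear * (c\<^sup>2 - s\<^sup>2) - 61 * (2 * s * c))) * c"
    unfolding E using shear(1) sc by algebra
  have "height' t * lift' t = s * radius t * (7 / 650 * ((- 25 * s - 7 * shear * c) * quad t
      + 25 / 14 * (25 * c - 7 * shear * s) * (2 * shear * (c\<^sup>2 - s\<^sup>2) - 8 * s * c)))
      * (quad t powr (- 11 / 14) * quad t powr (11 / 14))"
    unfolding height'_def lift'_def s_def[symmetric] c_def[symmetric] by (simp only: mult_ac)
  then show "height' t * lift' t = 8 / 3 * (radius' t * sin t * cos t)"
    unfolding first quad_powr(2) radius'_def double s_def[symmetric] c_def[symmetric] by simp
  have second: "4 * (7 / 650 * (25 * c - 7 * shear * s) * quad t)
      = 6 * c + 7 / 3 * (6 / 325 * (11 * shear * (c\<^sup>2 - s\<^sup>2) - 61 * (2 * s * c))) * s"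
    unfolding E using shear(1) sc by algebra
  have "4 * (height' t * lift t) = s * radius t * (4 * (7 / 650 * (25 * c - 7 * shear * s) * quad t))
      * (quad t powr (- 11 / 14) * quad t powr (11 / 14))"
    unfolding height'_def lift_def quad_powr(1) s_def[symmetric] c_def[symmetric] by (simp only: mult_ac)
  then show "4 * (height' t * lift t)
      = 6 * (radius t * sin t * cos t) + 7 / 3 * (radius' t * (sin t)\<^sup>2)"
    unfolding second quad_powr(2) radius'_def double s_def[symmetric] c_def[symmetric]
    by (simp add: power2_eq_square[of s] distrib_left)
qed

text \<open>
  The complex function \<open>qc\<close> extends \<open>quad\<close> and avoids the branch cut of the logarithm near the real axis,
  so the powers of \<open>quad\<close> extend holomorphically. The function \<open>height\<close> is handled through its derivative.
\<close>

lemma profile_analytic: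
  "power_series_at radius t" "power_series_at height t" "power_series_at lift t"
proof -
  have cs: "cos (of_real y) = (of_real (cos y) :: complex)" "sin (of_real y) = (of_real (sin y) :: complex)"
    "cos (2 * of_real y) = (of_real (cos (2 * y)) :: complex)" "sin (2 * of_real y) = (of_real (sin (2 * y)) :: complex)" for y
    using cos_of_real[of "2 * y"] sin_of_real[of "2 * y"] by (simp_all add: cos_of_real sin_of_real)
  define rc where "rc w = exp (3 / 325 * (11 * of_real shear * sin (2 * w) + 61 * cos (2 * w)))" for w :: complex
  have rc: "rc (of_real y) = of_real (radius y)" for y
    unfolding rc_def radius_def cs by (simp flip: exp_of_real)
  show "power_series_at radius t"
  proof (rule power_series_at_entire)
    show "rc (of_real y) = of_real (radius y)" for y by (rule rc)
    show "rc holomorphic_on UNIV" unfolding rc_def by (intro holomorphic_intros)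
  qed
  define qc where "qc w = 11 / 7 + 4 * (cos w)\<^sup>2 + 2 * of_real shear * sin w * cos w" for w :: complex
  have qc: "qc (of_real y) = of_real (quad y)" for y
    unfolding qc_def quad_def cs by simp
  define U where "U = {w. qc w \<notin> \<real>\<^sub>\<le>\<^sub>0}"
  have "continuous_on UNIV qc" unfolding qc_def by (intro continuous_intros)
  then have "open (qc -` (- \<real>\<^sub>\<le>\<^sub>0))" by (intro open_vimage) auto
  then have U: "open U" by (simp add: U_def vimage_def)
  have real_U: "of_real y \<in> U" for y
    using quad_pos[of y] by (simp add: U_def qc)
  have hol: "qc holomorphic_on U" "rc holomorphic_on U"
    unfolding qc_def rc_def by (intro holomorphic_intros)+
  define pc where "pc a w = exp (of_real a * Ln (qc w))" for a and w :: complex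
  have hol_pow: "pc a holomorphic_on U" for a
    unfolding pc_def by (intro holomorphic_intros hol) (simp add: U_def)
  have pow: "pc a (of_real y) = of_real (quad y powr a)" for a y
    using quad_pos[of y]
    by (simp add: pc_def qc Ln_of_real powr_def less_imp_neq[symmetric] exp_of_real flip: of_real_mult)
  show "power_series_at lift t"
  proof (rule power_series_at_holomorphic_extension[OF U real_U])
    let ?g = "\<lambda>w. 7 / 650 * (25 * cos w - 7 * of_real shear * sin w) * pc (25 / 14) w"
    show "?g holomorphic_on U" by (intro holomorphic_intros hol_pow)
    show "?g (of_real y) = of_real (lift y)" for y
      unfolding pow cs lift_def by simp
  qed
  show "power_series_at height t"
  proof (rule power_series_at_primitive[OF U real_U])
    let ?g = "\<lambda>w. sin w * rc w * pc (- 11 / 14) w"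
    show "?g holomorphic_on U" by (intro holomorphic_intros hol hol_pow)
    show "?g (of_real y) = of_real (height' y)" for y
      unfolding pow cs rc height'_def by simp
  qed (rule height_deriv)
qed

lemma flexible_profile_exists:
  obtains \<kappa> where "flexible_profile radius height lift radius' height' lift' \<kappa>"
proof -
  obtain \<kappa> where \<kappa>: "\<kappa> > 0" "height 0 < 0" "\<And>t. \<bar>height t\<bar> \<le> - height 0 - \<kappa> * (sin t)\<^sup>2"
    by (rule height_bounds) (rule that)
  have "flexible_profile radius height lift radius' height' lift' \<kappa>"
  proof
    show "radius' t \<noteq> 0 \<or> height' t \<noteq> 0" for t
    proof (cases "sin t = 0")
      case True
      then have "(cos t)\<^sup>2 = 1" by (simp add: cos_squared_eq)
      then have "cos (2 * t) = 1" "sin (2 * t) = 0" using True by (simp_all add: cos_double sin_double)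
      then show ?thesis using radius_pos[of t] shear(2) by (simp add: radius'_def)
    next
      case False
      then show ?thesis using radius_pos[of t] quad_pos[of t] by (simp add: height'_def)
    qed
    show "lift 0 > 0" using quad_pos[of 0] by (simp add: lift_def)
  qed (fact radius_deriv height_deriv lift_deriv profile_analytic profile_shift height_shift
      radius_pos profile_bending \<kappa> | intro continuous_intros)+
  then show ?thesis by (rule that)
qed

section \<open>Two isometric tori that are not congruent\<close>

(* The type complex * complex only supplies a point set of continuum cardinality, which every
   torus has; the topology T on a subset of it is arbitrary. *)
theorem theorem2:
  shows "\<exists>(T :: (complex \<times> complex) topology) A
           (f_plus :: complex \<times> complex \<Rightarrow> real ^ 3) (f_minus :: complex \<times> complex \<Rightarrow> real ^ 3).
           real_analytic_torus T A \<and>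
           real_analytic_immersion A f_plus \<and>
           real_analytic_immersion A f_minus \<and>
           same_induced_metric A f_plus f_minus \<and>
           \<not> related_by_ambient_isometry T A f_plus f_minus"
proof -
  obtain \<kappa> where "flexible_profile radius height lift radius' height' lift' \<kappa>"
    by (rule flexible_profile_exists)
  then interpret flexible_profile radius height lift radius' height' lift' \<kappa> .
  show ?thesis
    using real_analytic_torus_torus_space noncongruent_isometric_tori by blast
qed

end
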